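(* For $n\ge 1$ let $\gamma_n(q)=T_n(q)^{1/(2n)}$ for $q\in(-1,1)$ (positive real root), where $T_n(q)=\sum_{\pi\in\mathcal P(2n)}q^{\mathrm{cr}(\pi)}$. Let $B_{\mathbb C}=\{z\in\mathbb C:|z|<1\}$. For every $n\ge1$, the function $$q\mapsto \frac{1}{(1-q)^n}\sum_{k=-n}^{n}(-1)^k q^{k(k-1)/2}\binom{2n}{n+k}$$ admits an analytic $2n$-th root $\tilde\gamma_n$ on $B_{\mathbb C}$ which coincides with $\gamma_n$ on $(-1,1)$. Moreover $\tilde\gamma_n(q)\to \dfrac{2}{\sqrt{1-q}}$ (principal branch of the square root) for every $q\in B_{\mathbb C}$, and the convergence is uniform on compact subsets of $B_{\mathbb C}$.
   Context: A pairing of $[2n]=\{1,\dots,2n\}$ is a partition of $[2n]$ into $n$ two-element blocks; $\mathcal P(2n)$ denotes the set of all pairings of $[2n]$. Two blocks $\{a,b\}$ ($a<b$) and $\{c,d\}$ ($c<d$) cross if $a<c<b<d$ or $c<a<d<b$; $\mathrm{cr}(\pi)$ is the number of unordered pairs of blocks of $\pi$ that cross. By the Touchard–Riordan formula (a known result), $T_n(q)=\frac{1}{(1-q)^n}\sum_{k=-n}^{n}(-1)^k q^{k(k-1)/2}\binom{2n}{n+k}$ for all $q$ with $q\neq 1$. The quantity $\gamma_n(q)$ is the $2n$-norm of the $q$-semicircular operator, and $\lim_n\gamma_n(q)$ is its operator norm. *)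

theory Defs
  imports "HOL-Analysis.Analysis" "HOL-Library.Disjoint_Sets"
begin

definition pairings :: "nat \<Rightarrow> nat set set set" where
  "pairings n = {P. partition_on {1..2*n} P \<and> (\<forall>b\<in>P. card b = 2)}"

definition crosses :: "nat set \<Rightarrow> nat set \<Rightarrow> bool" where
  "crosses B C \<longleftrightarrow> (\<exists>a b c d. B = {a,b} \<and> a < b \<and> C = {c,d} \<and> c < d \<and>
      ((a < c \<and> c < b \<and> b < d) \<or> (c < a \<and> a < d \<and> d < b)))"

definition cr :: "nat set set \<Rightarrow> nat" where
  "cr P = card {{B, C} | B C. B \<in> P \<and> C \<in> P \<and> crosses B C}"

definition T :: "nat \<Rightarrow> real \<Rightarrow> real" where
  "T n q = (\<Sum>P\<in>pairings n. q ^ cr P)"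

definition gamma :: "nat \<Rightarrow> real \<Rightarrow> real" where
  "gamma n q = root (2*n) (T n q)"

text \<open>The Touchard--Riordan expression, as a function of complex q.\<close>
definition TR :: "nat \<Rightarrow> complex \<Rightarrow> complex" where
  "TR n q = 1 / (1 - q) ^ n *
     (\<Sum>k\<in>{-int n..int n}. (-1) ^ nat \<bar>k\<bar> * q ^ nat (k * (k - 1) div 2)
        * of_nat ((2*n) choose nat (int n + k)))"

end

(* Write S_n = (1 - q)^n T_n = sum_{k=0}^n (-1)^k a_{n,k} q^(k(k+1)/2) with ballot numbers a_{n,k}.
   The main point is that S_n has no zero in the open unit disc.  The recurrence of the ballot
   numbers gives (N - q d/dq) S_{n+1} = (n+1)(2n+1) S_n with N = (n+1)(n+2)/2 = deg S_{n+1}, so by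
   Laguerre's theorem on polar derivatives zero-freeness of S_{n+1} on a disc around 0 is inherited
   by S_n.  After division by the Catalan number, S_n tends locally uniformly to
   sum_k (-1)^k (2k+1) q^(k(k+1)/2), which by Jacobi is prod_m (1 - q^m)^3 and hence non-zero.
   So S_N is zero-free on any smaller disc for large N, and then S_n is zero-free for every n.
   The logarithms of the normalised S_n are bounded on compact sets, so their 2n-th roots tend to 1,
   while the 2n-th root of the Catalan number tends to 2.

   On the real interval, T_n is identified with the sum by deleting the largest point of a pairing:
   this is a recursion over heights of Dyck paths with weights 1 + q + ... + q^h, solved
   explicitly. *)

theory Submission
  imports Defs "HOL-Complex_Analysis.Complex_Analysis" "HOL-Real_Asymp.Real_Asymp"
    "HOL-Computational_Algebra.Fundamental_Theorem_Algebra"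
begin

text \<open>An analytic root on the whole disc requires zero-freeness for each single n. Locally
  uniform convergence alone gives it only for large n and on smaller discs; the polar derivative
  supplies the missing direction, from n + 1 down to n with the same radius, so that the argument
  can start at infinity, where the Euler product decides. The Catalan number is the value of S_n at
  0. Dividing by it makes every normalised sum equal to 1 at the origin, which provides logarithms
  with value 0 there. They are bounded through their derivatives, which are quotients controlled
  uniformly in n, so no branch has to be matched with a logarithm of the limit. The same anchor,
  together with real coefficients, makes the root positive on the real interval. For pairings the
  obstacle is that a crossing is visible only once both arcs are known, whereas a recursion sees one
  point at a time. Treating unfinished arcs as infinite charges each crossing to the moment when the
  first of its two arcs closes.\<close>

section \<open>Pairings with open arcs\<close>

text \<open>Singleton blocks are arcs that are still open; \<open>overlaps\<close> treats \<open>{a}\<close> as the arc from \<open>a\<close> to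
  infinity, and is ordered (the first arc starts first), so that each crossing is counted once.\<close>

definition open_pairings :: "nat \<Rightarrow> nat set set set" where
  "open_pairings N = {P. partition_on {1..N} P \<and> (\<forall>b\<in>P. \<exists>a c. a \<le> c \<and> b = {a, c})}"

definition singles :: "nat set set \<Rightarrow> nat set" where
  "singles P = {a. {a} \<in> P}"

definition overlaps :: "nat set \<Rightarrow> nat set \<Rightarrow> bool" where
  "overlaps B C \<longleftrightarrow> Min B < Min C \<and> Min C < Max B \<and> (Min C = Max C \<or> Max B < Max C)"

definition overlapping :: "nat set set \<Rightarrow> (nat set \<times> nat set) set" where
  "overlapping P = {(B, C). B \<in> P \<and> C \<in> P \<and> overlaps B C}"

definition close_at :: "nat \<Rightarrow> nat set set \<Rightarrow> nat \<Rightarrow> nat set set" where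
  "close_at N P a = insert {a, Suc N} (P - {{a}})"

lemma finite_open_pairings [simp]: "finite (open_pairings N)"
  unfolding open_pairings_def
  by (rule finite_subset[OF _ finitely_many_partition_on[of "{1..N}"]]) auto

lemma open_pairingsD:
  assumes "P \<in> open_pairings N"
  shows "partition_on {1..N} P" "finite P" "\<And>b. b \<in> P \<Longrightarrow> b \<subseteq> {1..N}"
    "\<And>b. b \<in> P \<Longrightarrow> \<exists>a c. a \<le> c \<and> b = {a, c}" "singles P \<subseteq> {1..N}" "finite (singles P)"
proof -
  show 1: "partition_on {1..N} P" and "\<And>b. b \<in> P \<Longrightarrow> \<exists>a c. a \<le> c \<and> b = {a, c}"
    using assms by (auto simp: open_pairings_def)
  show "finite P"
    using finite_elements[OF _ 1] by simp
  show 2: "b \<subseteq> {1..N}" if "b \<in> P" for b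
    using partition_onD1[OF 1] that by auto
  show "singles P \<subseteq> {1..N}"
    using 2 by (auto simp: singles_def)
  then show "finite (singles P)"
    using finite_subset by blast
qed

lemma finite_overlapping: "finite P \<Longrightarrow> finite (overlapping P)"
  by (rule finite_subset[of _ "P \<times> P"]) (auto simp: overlapping_def)

lemma disjnt_Union_Diff:
  assumes "partition_on A P" "b \<in> P"
  shows "disjnt b (\<Union>(P - {b}))"
  using assms unfolding partition_on_def pairwise_def disjnt_def by auto

text \<open>An open arc already counts as infinite, so ending it at \<open>Suc N\<close> keeps the
  overlaps in which it is the later arc. New overlaps arise only with open arcs that started after
  it.\<close>

lemma overlaps_Suc_iff:
  assumes "b \<subseteq> {1..N}" "\<exists>a c. a \<le> c \<and> b = {a, c}" "a \<le> N"
  shows "overlaps b {a, Suc N} \<longleftrightarrow> overlaps b {a}"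
    and "overlaps {a, Suc N} b \<longleftrightarrow> (\<exists>c. b = {c} \<and> a < c)"
    and "\<not> overlaps {a} b" "\<not> overlaps {Suc N} b" "\<not> overlaps b {Suc N}"
proof -
  obtain x y where xy': "x \<le> y" "b = {x, y}"
    using assms(2) by blast
  have xy: "x \<le> y" "b = {x, y}" "y \<le> N"
    using xy' assms(1) by auto
  show "overlaps b {a, Suc N} \<longleftrightarrow> overlaps b {a}"
    "\<not> overlaps {a} b" "\<not> overlaps {Suc N} b" "\<not> overlaps b {Suc N}"
    using xy assms(3) by (auto simp: overlaps_def)
  show "overlaps {a, Suc N} b \<longleftrightarrow> (\<exists>c. b = {c} \<and> a < c)"
    using xy assms(3) by (auto simp: overlaps_def doubleton_eq_iff)
qed

lemma insert_single_open:
  assumes "P \<in> open_pairings N"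
  shows "insert {Suc N} P \<in> open_pairings (Suc N)"
    "singles (insert {Suc N} P) = insert (Suc N) (singles P)"
    "overlapping (insert {Suc N} P) = overlapping P"
proof -
  note P = open_pairingsD[OF assms]
  have "{1..Suc N} - {Suc N} = {1..N}" by auto
  then have "partition_on {1..Suc N} (insert {Suc N} P)"
    using P(1) partition_onD1[OF P(1)] by (subst partition_on_insert) (auto simp: disjnt_def)
  then show "insert {Suc N} P \<in> open_pairings (Suc N)"
    using assms by (auto simp: open_pairings_def)
  show "singles (insert {Suc N} P) = insert (Suc N) (singles P)"
    by (auto simp: singles_def)
  have nov: "\<not> overlaps {Suc N} {Suc N}"
    by (simp add: overlaps_def)
  show "overlapping (insert {Suc N} P) = overlapping P"
    unfolding overlapping_def using overlaps_Suc_iff(4,5)[OF P(3) P(4) order_refl] nov by blast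
qed

text \<open>The last equation is the source of the weights: closing \<open>a\<close> creates one
  crossing for each open arc that started after \<open>a\<close>, while the closed arc is nested in
  the open arcs that started earlier.\<close>

lemma close_at_open:
  assumes "P \<in> open_pairings N" "a \<in> singles P"
  shows "close_at N P a \<in> open_pairings (Suc N)"
    "singles (close_at N P a) = singles P - {a}"
    "{Suc N} \<notin> close_at N P a"
    "card (overlapping (close_at N P a)) =
       card (overlapping P) + card {c \<in> singles P. a < c}"
proof -
  note P = open_pairingsD[OF assms(1)]
  define Q where "Q = P - {{a}}"
  have aP: "{a} \<in> P" and aN: "1 \<le> a" "a \<le> N"
    using assms(2) P(5) by (auto simp: singles_def)
  then have PQ: "P = insert {a} Q" and aQ: "{a} \<notin> Q"
    by (auto simp: Q_def)
  have disj: "disjnt {a} (\<Union>Q)"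
    using disjnt_Union_Diff[OF P(1) aP] by (simp add: Q_def)
  then have partQ: "partition_on ({1..N} - {a}) Q"
    using P(1) partition_on_insert[OF disj] PQ by simp
  have Qsub: "b \<subseteq> {1..N}" "\<exists>a c. a \<le> c \<and> b = {a, c}" if "b \<in> Q" for b
    using P(3,4) that by (auto simp: Q_def)
  have "{1..Suc N} - {a, Suc N} = {1..N} - {a}" by auto
  moreover have "disjnt {a, Suc N} (\<Union>Q)"
    using disj Qsub(1) by (force simp: disjnt_def)
  ultimately have "partition_on {1..Suc N} (insert {a, Suc N} Q)"
    using partQ aN by (subst partition_on_insert) auto
  moreover have "\<forall>b\<in>insert {a, Suc N} Q. \<exists>a c. a \<le> c \<and> b = {a, c}"
    using Qsub(2) aN(2) by (metis insert_iff le_SucI)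
  ultimately show "close_at N P a \<in> open_pairings (Suc N)"
    by (simp add: open_pairings_def close_at_def Q_def)
  show "singles (close_at N P a) = singles P - {a}"
    using aN by (auto simp: singles_def close_at_def)
  show NS: "{Suc N} \<notin> close_at N P a"
    using aN P(3)[of "{Suc N}"] by (auto simp: close_at_def)
  have nov1: "\<not> overlaps {a} {a}"
    by (simp add: overlaps_def)
  \<comment> \<open>In \<open>P\<close> the arc \<open>{a}\<close> occurs only as second component:
    an arc without an end is never the first of an overlapping pair.\<close>
  have Q1: "overlapping P = overlapping Q \<union> (\<lambda>b. (b, {a})) ` {b\<in>Q. overlaps b {a}}"
    using overlaps_Suc_iff(3)[OF Qsub aN(2)] nov1 unfolding PQ overlapping_def by blast
  have nov: "\<not> overlaps {a, Suc N} {a, Suc N}"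
    by (simp add: overlaps_def)
  have "overlapping (insert {a, Suc N} Q) = overlapping Q \<union>
      (\<lambda>b. (b, {a, Suc N})) ` {b\<in>Q. overlaps b {a, Suc N}} \<union>
      (\<lambda>b. ({a, Suc N}, b)) ` {b\<in>Q. overlaps {a, Suc N} b}"
    using nov unfolding overlapping_def by blast
  also have "{b\<in>Q. overlaps b {a, Suc N}} = {b\<in>Q. overlaps b {a}}"
    using overlaps_Suc_iff(1)[OF Qsub aN(2)] by blast
  also have "{b\<in>Q. overlaps {a, Suc N} b} = (\<lambda>c. {c}) ` {c \<in> singles P. a < c}"
  proof -
    have "{c} \<in> Q \<longleftrightarrow> {c} \<in> P" if "a < c" for c
      using that by (simp add: Q_def)
    then show ?thesis
      using overlaps_Suc_iff(2)[OF Qsub aN(2)] unfolding singles_def by blast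
  qed
  finally have Q2: "overlapping (insert {a, Suc N} Q) = overlapping Q \<union>
      (\<lambda>b. (b, {a, Suc N})) ` {b\<in>Q. overlaps b {a}} \<union>
      (\<lambda>c. ({a, Suc N}, {c})) ` {c \<in> singles P. a < c}"
    by (simp add: image_image)
  have "finite Q" using P(2) by (simp add: Q_def)
  have aS: "{a, Suc N} \<notin> Q" using Qsub by fastforce
  have fin: "finite (overlapping Q)"
    by (rule finite_overlapping) fact
  have "card (overlapping P) = card (overlapping Q) + card {b\<in>Q. overlaps b {a}}"
    unfolding Q1 using \<open>finite Q\<close> aQ fin
    by (subst card_Un_disjoint) (auto simp: card_image inj_on_def overlapping_def)
  moreover have "card (overlapping (insert {a, Suc N} Q)) = card (overlapping Q) + card {b\<in>Q. overlaps b {a}}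
     + card {c \<in> singles P. a < c}"
  proof -
    have "overlapping Q \<inter> (\<lambda>b. (b, {a, Suc N})) ` {b\<in>Q. overlaps b {a}} = {}"
      using aS by (auto simp: overlapping_def)
    moreover have "(overlapping Q \<union> (\<lambda>b. (b, {a, Suc N})) ` {b\<in>Q. overlaps b {a}}) \<inter>
        (\<lambda>c. ({a, Suc N}, {c})) ` {c \<in> singles P. a < c} = {}"
      using aS by (auto simp: overlapping_def)
    ultimately show ?thesis
      unfolding Q2 using \<open>finite Q\<close> P(6) fin
      by (simp add: card_Un_disjoint card_image inj_on_def)
  qed
  ultimately show "card (overlapping (close_at N P a)) =
       card (overlapping P) + card {c \<in> singles P. a < c}"
    by (simp add: close_at_def Q_def)
qed

section \<open>Removing the largest point\<close>

lemma bij_insert_single: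
  "bij_betw (insert {Suc N}) {P \<in> open_pairings N. card (singles P) = h}
     {R \<in> open_pairings (Suc N). {Suc N} \<in> R \<and> card (singles R) = Suc h}"
proof (rule bij_betw_imageI)
  have notin: "{Suc N} \<notin> P" if "P \<in> open_pairings N" for P
    using open_pairingsD(3)[OF that] by force
  then have notin': "Suc N \<notin> singles P" if "P \<in> open_pairings N" for P
    using that by (auto simp: singles_def)
  show "inj_on (insert {Suc N}) {P \<in> open_pairings N. card (singles P) = h}"
    using notin by (intro inj_onI) (metis (no_types, lifting) insert_ident mem_Collect_eq)
  show "insert {Suc N} ` {P \<in> open_pairings N. card (singles P) = h} =
    {R \<in> open_pairings (Suc N). {Suc N} \<in> R \<and> card (singles R) = Suc h}" (is "?l = ?r")
  proof
    show "?l \<subseteq> ?r"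
    proof
      fix R assume "R \<in> ?l"
      then obtain P where P: "R = insert {Suc N} P" "P \<in> open_pairings N" "card (singles P) = h"
        by blast
      then show "R \<in> ?r"
        by (simp add: insert_single_open notin' open_pairingsD(6))
    qed
    show "?r \<subseteq> ?l"
    proof
      fix R assume "R \<in> ?r"
      then have R: "R \<in> open_pairings (Suc N)" "{Suc N} \<in> R" "card (singles R) = Suc h"
        by auto
      define P where "P = R - {{Suc N}}"
      have RP: "R = insert {Suc N} P" using R by (auto simp: P_def)
      have "disjnt {Suc N} (\<Union>P)"
        using disjnt_Union_Diff[OF open_pairingsD(1)[OF R(1)] R(2)] by (simp add: P_def)
      moreover have "{1..Suc N} - {Suc N} = {1..N}" by auto
      ultimately have "partition_on {1..N} P"
        using open_pairingsD(1)[OF R(1)] partition_on_insert RP by metis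
      then have P: "P \<in> open_pairings N"
        using R(1) by (auto simp: open_pairings_def P_def)
      moreover have "card (singles P) = h"
        using R(3) insert_single_open(2)[OF P] notin'[OF P] open_pairingsD(6)[OF P] RP by simp
      ultimately show "R \<in> ?l" using RP by blast
    qed
  qed
qed

text \<open>The inverse reads \<open>a\<close> off the block that contains \<open>Suc N\<close> and
  reopens it; the domain therefore consists of configurations with a marked open arc.\<close>

lemma bij_close_at:
  "bij_betw (\<lambda>(P, a). close_at N P a)
     (SIGMA P:{P \<in> open_pairings N. card (singles P) = Suc h}. singles P)
     {R \<in> open_pairings (Suc N). {Suc N} \<notin> R \<and> card (singles R) = h}"
proof (rule bij_betw_imageI)
  let ?S = "SIGMA P:{P \<in> open_pairings N. card (singles P) = Suc h}. singles P"
  let ?T = "{R \<in> open_pairings (Suc N). {Suc N} \<notin> R \<and> card (singles R) = h}"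
  have notin: "\<And>b. b \<in> P \<Longrightarrow> Suc N \<notin> b" if "P \<in> open_pairings N" for P
    using open_pairingsD(3)[OF that] by force
  show "inj_on (\<lambda>(P, a). close_at N P a) ?S"
  proof (rule inj_onI; clarify)
    fix P a P' a'
    assume P: "P \<in> open_pairings N" "a \<in> singles P" and P': "P' \<in> open_pairings N" "a' \<in> singles P'"
      and eq: "close_at N P a = close_at N P' a'"
    have "{a, Suc N} \<in> close_at N P' a'"
      using eq by (auto simp: close_at_def)
    then have aa: "a = a'"
      using notin[OF P'(1)] by (auto simp: close_at_def doubleton_eq_iff)
    have "{a, Suc N} \<notin> P - {{a}}" "{a, Suc N} \<notin> P' - {{a}}"
      using notin P(1) P'(1) by blast+
    then have "P - {{a}} = P' - {{a}}"
      using eq aa by (simp add: close_at_def insert_ident)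
    then have "P = P'"
      using P(2) P'(2) aa by (auto simp: singles_def)
    then show "P = P' \<and> a = a'" using aa by simp
  qed
  show "(\<lambda>(P, a). close_at N P a) ` ?S = ?T"
  proof
    show "(\<lambda>(P, a). close_at N P a) ` ?S \<subseteq> ?T"
    proof clarify
      fix P a assume "P \<in> open_pairings N" "a \<in> singles P" "card (singles P) = Suc h"
      then show "close_at N P a \<in> open_pairings (Suc N) \<and> {Suc N} \<notin> close_at N P a \<and>
          card (singles (close_at N P a)) = h"
        by (simp add: close_at_open(1-3) open_pairingsD(6))
    qed
    show "?T \<subseteq> (\<lambda>(P, a). close_at N P a) ` ?S"
    proof
      fix R assume "R \<in> ?T"
      then have R: "R \<in> open_pairings (Suc N)" "{Suc N} \<notin> R" "h = card (singles R)"
        by auto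
      note RD = open_pairingsD[OF R(1)]
      obtain b where b: "b \<in> R" "Suc N \<in> b"
      proof -
        have "Suc N \<in> \<Union>R" using partition_onD1[OF RD(1)] by auto
        then show ?thesis using that by blast
      qed
      obtain x y where "b = {x, y}"
        using RD(4)[OF b(1)] by blast
      then have "b = {x, Suc N} \<or> b = {y, Suc N}"
        using b(2) by auto
      then obtain a where ab: "b = {a, Suc N}"
        by blast
      have a: "b = {a, Suc N}" "a \<noteq> Suc N"
        using ab R(2) b(1) by auto
      then have aN: "1 \<le> a" "a \<le> N"
        using RD(3)[OF b(1)] by auto
      define Q where "Q = R - {b}"
      have RQ: "R = insert {a, Suc N} Q" using b a by (auto simp: Q_def)
      have disj: "disjnt {a, Suc N} (\<Union>Q)"
        using disjnt_Union_Diff[OF RD(1) b(1)] a by (simp add: Q_def)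
      have "{1..Suc N} - {a, Suc N} = {1..N} - {a}" by auto
      then have Q: "partition_on ({1..N} - {a}) Q"
        using RD(1) partition_on_insert[OF disj] RQ by metis
      have disj': "disjnt {a} (\<Union>Q)" using disj by (auto simp: disjnt_def)
      have "partition_on {1..N} (insert {a} Q)"
        using Q aN partition_on_insert[OF disj'] by auto
      moreover have "\<forall>b\<in>insert {a} Q. \<exists>a c. a \<le> c \<and> b = {a, c}"
        using RD(4) by (auto simp: Q_def)
      ultimately have P: "insert {a} Q \<in> open_pairings N"
        by (simp add: open_pairings_def)
      have aS: "a \<in> singles (insert {a} Q)" by (simp add: singles_def)
      have aQ: "{a} \<notin> Q" using disj' by (auto simp: disjnt_def)
      then have R': "R = close_at N (insert {a} Q) a"
        using RQ by (simp add: close_at_def)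
      have "card (singles (insert {a} Q)) = Suc h"
        using close_at_open(2)[OF P aS] R(3) R' aS open_pairingsD(6)[OF P]
        by (metis card_Suc_Diff1)
      then show "R \<in> (\<lambda>(P, a). close_at N P a) ` ?S"
        using P aS R' by (intro image_eqI[of _ _ "(insert {a} Q, a)"]) auto
    qed
  qed
qed

section \<open>Weighted path recursion\<close>

definition path_weight :: "real \<Rightarrow> nat \<Rightarrow> nat \<Rightarrow> real" where
  "path_weight q N h = (\<Sum>P | P \<in> open_pairings N \<and> card (singles P) = h. q ^ card (overlapping P))"

text \<open>The number of larger elements takes each of the values 0, ..., \<open>card A - 1\<close>
  once. The induction adds a new minimum, which has all of \<open>A\<close> above it and changes no
  other rank.\<close>

lemma sum_power_rank:
  fixes q :: real
  assumes "finite A"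
  shows "(\<Sum>a\<in>A. q ^ card {c \<in> A. a < (c::nat)}) = (\<Sum>i<card A. q ^ i)"
  using assms
proof (induction A rule: finite_linorder_min_induct)
  case (insert b A)
  have "{c \<in> insert b A. b < c} = A" using insert by auto
  moreover have "{c \<in> insert b A. a < c} = {c \<in> A. a < c}" if "a \<in> A" for a
    using insert that by auto
  ultimately have "(\<Sum>a\<in>insert b A. q ^ card {c \<in> insert b A. a < c}) =
      q ^ card A + (\<Sum>a\<in>A. q ^ card {c \<in> A. a < c})"
    using insert by (subst sum.insert) (auto intro!: sum.cong)
  then show ?case
    using insert by (subst card_insert_disjoint) auto
qed auto

text \<open>Either \<open>Suc N\<close> stays open, or it closes one of \<open>Suc h\<close> open
  arcs; by \<open>sum_power_rank\<close> the choice of that arc contributes 1 + q + ... +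
  q^h.\<close>

lemma path_weight_Suc:
  "path_weight q (Suc N) h =
     (if h = 0 then 0 else path_weight q N (h - 1)) + (\<Sum>i<Suc h. q ^ i) * path_weight q N (Suc h)"
proof -
  let ?w = "\<lambda>P. q ^ card (overlapping P)"
  let ?A = "{R \<in> open_pairings (Suc N). {Suc N} \<in> R \<and> card (singles R) = h}"
  let ?B = "{R \<in> open_pairings (Suc N). {Suc N} \<notin> R \<and> card (singles R) = h}"
  have "{P. P \<in> open_pairings (Suc N) \<and> card (singles P) = h} = ?A \<union> ?B" by auto
  then have "path_weight q (Suc N) h = sum ?w ?A + sum ?w ?B"
    unfolding path_weight_def by (simp add: sum.union_disjoint disjoint_iff)
  moreover have "sum ?w ?A = (if h = 0 then 0 else path_weight q N (h - 1))"
  proof (cases h)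
    case 0
    have "Suc N \<in> singles R" if "{Suc N} \<in> R" for R
      using that by (simp add: singles_def)
    then have "?A = {}"
      using 0 open_pairingsD(6) by fastforce
    then show ?thesis using 0 by (simp only: sum.empty) simp
  next
    case (Suc h')
    show ?thesis
      unfolding path_weight_def Suc
      by (subst sum.reindex_bij_betw[OF bij_insert_single, symmetric])
        (auto intro!: sum.cong simp: insert_single_open(3))
  qed
  moreover have "sum ?w ?B = (\<Sum>i<Suc h. q ^ i) * path_weight q N (Suc h)"
  proof -
    have "sum ?w ?B = (\<Sum>(P, a)\<in>(SIGMA P:{P \<in> open_pairings N. card (singles P) = Suc h}. singles P).
        ?w (close_at N P a))"
      by (subst sum.reindex_bij_betw[OF bij_close_at, symmetric]) (simp add: case_prod_beta)
    also have "\<dots> = (\<Sum>P | P \<in> open_pairings N \<and> card (singles P) = Suc h. \<Sum>a\<in>singles P. ?w (close_at N P a))"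
      using open_pairingsD(6) by (subst sum.Sigma) auto
    also have "\<dots> = (\<Sum>P | P \<in> open_pairings N \<and> card (singles P) = Suc h. (\<Sum>i<Suc h. q ^ i) * ?w P)"
    proof (rule sum.cong[OF refl], clarify)
      fix P assume P: "P \<in> open_pairings N" "card (singles P) = Suc h"
      have "(\<Sum>a\<in>singles P. ?w (close_at N P a)) = (\<Sum>a\<in>singles P. ?w P * q ^ card {c \<in> singles P. a < c})"
        by (intro sum.cong) (auto simp: close_at_open(4)[OF P(1)] power_add)
      also have "\<dots> = (\<Sum>i<Suc h. q ^ i) * ?w P"
        using sum_power_rank[OF open_pairingsD(6)[OF P(1)], of q] P(2)
        by (simp add: sum_distrib_left[symmetric] mult.commute)
      finally show "(\<Sum>a\<in>singles P. ?w (close_at N P a)) = (\<Sum>i<Suc h. q ^ i) * ?w P" .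
    qed
    finally show ?thesis by (simp add: path_weight_def sum_distrib_left)
  qed
  ultimately show ?thesis by simp
qed

lemma path_weight_0: "path_weight q 0 h = (if h = 0 then 1 else 0)"
proof -
  have "partition_on {1..0::nat} P \<longleftrightarrow> P = {}" for P
    by (simp add: partition_on_empty)
  then have "open_pairings 0 = {{}}"
    unfolding open_pairings_def by blast
  then have "{P. P \<in> open_pairings 0 \<and> card (singles P) = h} = (if h = 0 then {{}} else {})"
    by (simp add: singles_def Collect_conv_if)
  then show ?thesis
    by (simp add: path_weight_def overlapping_def)
qed

section \<open>From open pairings back to pairings and crossings\<close>

lemma pairings_eq: "pairings n = {P \<in> open_pairings (2 * n). card (singles P) = 0}"
proof (intro set_eqI iffI)
  fix P assume P: "P \<in> pairings n"
  then have "\<exists>a c. a \<le> c \<and> b = {a, c}" if "b \<in> P" for b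
  proof -
    have "card b = 2"
      using P that by (simp add: pairings_def)
    then obtain x y where "b = {x, y}"
      by (meson card_2_iff)
    then show ?thesis by (metis insert_commute linear)
  qed
  moreover have "singles P = {}"
    using P by (auto simp: singles_def pairings_def)
  ultimately show "P \<in> {P \<in> open_pairings (2 * n). card (singles P) = 0}"
    using P by (auto simp: open_pairings_def pairings_def)
next
  fix P assume P: "P \<in> {P \<in> open_pairings (2 * n). card (singles P) = 0}"
  then have "singles P = {}"
    using open_pairingsD(6) by auto
  have "card b = 2" if "b \<in> P" for b
  proof -
    obtain x y where xy: "b = {x, y}"
      using open_pairingsD(4)[of P "2*n" b] P \<open>b \<in> P\<close> by blast
    moreover have "x \<noteq> y"
      using xy \<open>b \<in> P\<close> \<open>singles P = {}\<close> by (auto simp: singles_def)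
    ultimately show ?thesis by simp
  qed
  then show "P \<in> pairings n"
    using P by (auto simp: open_pairings_def pairings_def)
qed

lemma cr_eq_overlapping:
  assumes "P \<in> pairings n"
  shows "cr P = card (overlapping P)"
proof -
  have crosses_iff: "crosses B C \<longleftrightarrow> overlaps B C \<or> overlaps C B" if "B \<in> P" "C \<in> P" for B C
  proof -
    have "\<exists>a b. a < b \<and> B = {a, b}" if "B \<in> P" for B
    proof -
      have "card B = 2"
        using assms that by (simp add: pairings_def)
      then obtain x y where "B = {x, y}" "x \<noteq> y"
        by (meson card_2_iff)
      then show ?thesis by (metis insert_commute nat_neq_iff)
    qed
    note * = this
    obtain a b where ab: "a < b" "B = {a, b}"
      using *[OF \<open>B \<in> P\<close>] by blast
    obtain c d where cd: "c < d" "C = {c, d}"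
      using *[OF \<open>C \<in> P\<close>] by blast
    have uniq: "a' = x \<and> b' = y" if "{x, y} = {a', b'}" "a' < b'" "x < y" for a' b' x y :: nat
      using that by (auto simp: doubleton_eq_iff)
    have "crosses B C \<longleftrightarrow> (a < c \<and> c < b \<and> b < d) \<or> (c < a \<and> a < d \<and> d < b)"
    proof
      assume "crosses B C"
      then obtain a' b' c' d' where *: "{a, b} = {a', b'}" "a' < b'" "{c, d} = {c', d'}" "c' < d'"
        "(a' < c' \<and> c' < b' \<and> b' < d') \<or> (c' < a' \<and> a' < d' \<and> d' < b')"
        unfolding crosses_def ab(2) cd(2) by blast
      show "(a < c \<and> c < b \<and> b < d) \<or> (c < a \<and> a < d \<and> d < b)"
        using *(5) uniq[OF *(1,2) ab(1)] uniq[OF *(3,4) cd(1)] by simp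
    next
      assume "(a < c \<and> c < b \<and> b < d) \<or> (c < a \<and> a < d \<and> d < b)"
      then show "crosses B C"
        unfolding crosses_def using ab cd by blast
    qed
    also have "\<dots> \<longleftrightarrow> overlaps B C \<or> overlaps C B"
      using ab cd by (auto simp: overlaps_def)
    finally show ?thesis .
  qed
  have "bij_betw (\<lambda>(B, C). {B, C}) (overlapping P) {{B, C} | B C. B \<in> P \<and> C \<in> P \<and> crosses B C}"
  proof (rule bij_betw_imageI)
    show "inj_on (\<lambda>(B, C). {B, C}) (overlapping P)"
      by (auto simp: inj_on_def overlapping_def overlaps_def doubleton_eq_iff)
    show "(\<lambda>(B, C). {B, C}) ` overlapping P = {{B, C} | B C. B \<in> P \<and> C \<in> P \<and> crosses B C}"
      (is "?l = ?r")
    proof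
      show "?l \<subseteq> ?r" using crosses_iff by (auto simp: overlapping_def)
      show "?r \<subseteq> ?l"
      proof clarify
        fix B C assume BC: "B \<in> P" "C \<in> P" "crosses B C"
        then have "(B, C) \<in> overlapping P \<or> (C, B) \<in> overlapping P"
          using crosses_iff by (auto simp: overlapping_def)
        then show "{B, C} \<in> ?l"
        proof
          assume "(B, C) \<in> overlapping P"
          then show ?thesis by (rule rev_image_eqI) simp
        next
          assume "(C, B) \<in> overlapping P"
          then show ?thesis by (rule rev_image_eqI) (simp add: insert_commute)
        qed
      qed
    qed
  qed
  then show ?thesis
    unfolding cr_def by (simp only: bij_betw_same_card)
qed

lemma T_eq_path_weight: "T n q = path_weight q (2 * n) 0"
  unfolding T_def path_weight_def pairings_eq
  by (intro sum.cong) (auto simp: cr_eq_overlapping pairings_eq)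

section \<open>The Touchard--Riordan formula\<close>

definition triangle :: "nat \<Rightarrow> nat" where
  "triangle k = k * (k + 1) div 2"

lemma triangle_simps [simp]: "triangle 0 = 0" "triangle (Suc k) = triangle k + Suc k"
  by (simp_all add: triangle_def)

text \<open>The q-Pochhammer symbol (q;q)_n.\<close>

definition qpoch :: "'a::comm_ring_1 \<Rightarrow> nat \<Rightarrow> 'a" where
  "qpoch q n = (\<Prod>i<n. 1 - q ^ Suc i)"

lemma qpoch_simps [simp]: "qpoch q 0 = 1" "qpoch q (Suc n) = qpoch q n * (1 - q ^ Suc n)"
  by (simp_all add: qpoch_def)

lemma power_Suc_neq_1:
  fixes q :: "'a::real_normed_field"
  assumes "norm q < 1"
  shows "q ^ Suc n \<noteq> 1"
proof -
  have "norm (q ^ Suc n) < 1"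
    unfolding norm_power using power_strict_mono[OF assms, of "Suc n"] by simp
  then show ?thesis by auto
qed

lemma qpoch_nonzero:
  fixes q :: "'a::real_normed_field"
  assumes "norm q < 1"
  shows "qpoch q n \<noteq> 0"
  using power_Suc_neq_1[OF assms] by (simp add: qpoch_def del: power_Suc)

text \<open>By the reflection principle this counts nonnegative lattice paths of length
  \<open>N\<close> with \<open>m\<close> down steps as long as \<open>2 * m \<le> N\<close>. It is
  integer valued because the difference becomes negative further on.\<close>

definition ballot :: "nat \<Rightarrow> nat \<Rightarrow> int" where
  "ballot N m = int (N choose m) - (if m = 0 then 0 else int (N choose (m - 1)))"

lemma ballot_Suc: "ballot (Suc N) (Suc m) = ballot N (Suc m) + ballot N m"
  by (cases m) (auto simp: ballot_def)

lemma ballot_0 [simp]: "ballot N 0 = 1"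
  by (simp add: ballot_def)

text \<open>The two middle binomials of an odd row agree. In the path recursion this is the boundary
  condition at height 0.\<close>

lemma ballot_mid: "ballot (Suc (2 * m)) (Suc m) = 0"
  by (simp add: ballot_def binomial_symmetric[of m "Suc (2 * m)"] del: binomial_Suc_Suc)

lemma path_weight_eq_0: "N < h \<Longrightarrow> path_weight q N h = 0"
  by (induction N arbitrary: h) (auto simp: path_weight_0 path_weight_Suc)

text \<open>The path weights are the coefficients of \<open>x\<^sup>N\<close> in the basis of \<open>q\<close>-Hermite polynomials,
  which is where the closed form comes from.\<close>

lemma path_weight_formula:
  assumes q: "\<bar>q\<bar> < 1" and N: "N = h + 2 * j"
  shows "(1 - q) ^ j * qpoch q h * path_weight q N h =
    (\<Sum>i\<le>j. (-1) ^ i * q ^ triangle i / qpoch q i * qpoch q (h + i) * of_int (ballot N (j - i)))"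
  using N
proof (induction N arbitrary: h j)
  case 0
  then show ?case by (simp add: path_weight_0)
next
  case (Suc N)
  define E where "E i = (-1) ^ i * q ^ triangle i / qpoch q i" for i
  note nz = qpoch_nonzero[of q]
  have E_Suc: "E (Suc i) * (1 - q ^ Suc i) = - E i * q ^ Suc i" for i
  proof -
    have "1 - q ^ Suc i \<noteq> 0"
      using power_Suc_neq_1[of q i] q by simp
    moreover have "E (Suc i) = - E i * q ^ Suc i / (1 - q ^ Suc i)"
      by (simp add: E_def power_add)
    ultimately show ?thesis
      by (metis nonzero_eq_divide_eq)
  qed
  define W where "W h = path_weight q N h" for h
  have rec: "path_weight q (Suc N) h = (if h = 0 then 0 else W (h - 1)) + (\<Sum>i<Suc h. q ^ i) * W (Suc h)"
    by (simp add: W_def path_weight_Suc del: sum.lessThan_Suc)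
  have geo: "(1 - q) * (\<Sum>i<Suc h. q ^ i) = 1 - q ^ Suc h"
    by (rule one_diff_power_eq[symmetric])
  have IH: "(1 - q) ^ j * qpoch q h * W h =
       (\<Sum>i\<le>j. E i * qpoch q (h + i) * of_int (ballot N (j - i)))" if "N = h + 2 * j" for h j
    using Suc.IH[OF that] by (simp add: W_def E_def)
  have up: "(1 - q) ^ j * qpoch q h * (if h = 0 then 0 else W (h - 1)) =
       (\<Sum>i\<le>j. E i * (if h = 0 then 0 else (1 - q ^ h) * qpoch q (h - 1 + i)) * of_int (ballot N (j - i)))"
  proof (cases h)
    case (Suc h')
    then have "(1 - q) ^ j * qpoch q h' * W h' * (1 - q ^ h) =
       (\<Sum>i\<le>j. E i * qpoch q (h' + i) * of_int (ballot N (j - i))) * (1 - q ^ h)"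
      using IH[of h' j] Suc.prems by simp
    then show ?thesis
      using Suc by (simp add: sum_distrib_left sum_distrib_right mult_ac del: power_Suc)
  qed simp
  show ?case
  proof (cases j)
    case 0
    \<comment> \<open>With \<open>j = 0\<close> all steps go up, so the down-step term refers to a
      height that cannot be reached.\<close>
    then have "h = Suc N" using Suc.prems by simp
    moreover have "W (Suc (Suc N)) = 0"
      by (simp add: W_def path_weight_eq_0)
    ultimately show ?thesis
      using up 0 rec by (simp add: E_def mult_ac)
  next
    case (Suc k)
    have *: "N = Suc h + 2 * k" using Suc.prems Suc by simp
    have down: "(1 - q) ^ j * qpoch q h * ((\<Sum>i<Suc h. q ^ i) * W (Suc h)) =
      (\<Sum>i\<le>k. E i * qpoch q (Suc h + i) * of_int (ballot N (k - i)))"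
    proof -
      have "(1 - q) ^ j * qpoch q h * ((\<Sum>i<Suc h. q ^ i) * W (Suc h)) =
         (1 - q) ^ k * qpoch q h * ((1 - q) * (\<Sum>i<Suc h. q ^ i)) * W (Suc h)"
        using Suc by (simp add: mult_ac)
      then show ?thesis
        unfolding geo IH[OF *, symmetric] by (simp add: mult_ac)
    qed
    have "(\<Sum>i\<le>j. E i * qpoch q (h + i) * of_int (ballot (Suc N) (j - i))) =
      (\<Sum>i\<le>j. E i * qpoch q (h + i) * of_int (ballot N (j - i))) +
      (\<Sum>i\<le>k. E i * qpoch q (h + i) * of_int (ballot N (k - i)))"
      unfolding Suc by (simp add: ballot_Suc Suc_diff_le sum.distrib algebra_simps)
    moreover have "(\<Sum>i\<le>j. E i * qpoch q (h + i) * of_int (ballot N (j - i))) -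
       (\<Sum>i\<le>j. E i * (if h = 0 then 0 else (1 - q ^ h) * qpoch q (h - 1 + i)) * of_int (ballot N (j - i))) =
       (\<Sum>i\<le>k. E i * qpoch q (Suc h + i) * of_int (ballot N (k - i))) -
       (\<Sum>i\<le>k. E i * qpoch q (h + i) * of_int (ballot N (k - i)))" (is "?L = ?R")
    proof -
      \<comment> \<open>\<open>D\<close> measures by how much the up-step sum misses the ballot sum
        with the same indices. For positive \<open>i\<close> it has the factor 1 - q^i, which
        \<open>E_Suc\<close> converts into a shift of \<open>i\<close>.\<close>
      define D where "D i = qpoch q (h + i) - (if h = 0 then 0 else (1 - q ^ h) * qpoch q (h - 1 + i))" for i
      have "?L = (\<Sum>i\<le>j. E i * D i * of_int (ballot N (j - i)))"
        unfolding D_def by (simp add: sum_subtractf algebra_simps)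
      also have "\<dots> = (\<Sum>i\<le>k. E (Suc i) * D (Suc i) * of_int (ballot N (k - i)))"
      proof -
        \<comment> \<open>For positive \<open>h\<close> the factor \<open>D 0\<close> vanishes; for
          \<open>h = 0\<close> it is 1, and the ballot number is the vanishing one of
          \<open>ballot_mid\<close>.\<close>
        have "D 0 * of_int (ballot N j) = 0"
          using Suc * ballot_mid[of k] by (cases h) (auto simp: D_def)
        then show ?thesis
          unfolding Suc by (simp only: sum.atMost_Suc_shift) (simp add: mult.assoc)
      qed
      also have "\<dots> = (\<Sum>i\<le>k. (- E i * q ^ Suc i * q ^ h * qpoch q (h + i)) * of_int (ballot N (k - i)))"
      proof (rule sum.cong[OF refl], rule arg_cong2[OF _ refl, where f = "(*)"])
        fix i
        have "D (Suc i) = (1 - q ^ Suc i) * (q ^ h * qpoch q (h + i))"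
          by (cases h) (simp_all add: D_def power_add algebra_simps)
        then have "E (Suc i) * D (Suc i) = (E (Suc i) * (1 - q ^ Suc i)) * (q ^ h * qpoch q (h + i))"
          by (simp only: mult_ac)
        then show "E (Suc i) * D (Suc i) = - E i * q ^ Suc i * q ^ h * qpoch q (h + i)"
          unfolding E_Suc by (simp only: mult_ac)
      qed
      also have "\<dots> = ?R"
        unfolding sum_subtractf[symmetric] by (intro sum.cong) (simp_all add: power_add algebra_simps)
      finally show ?thesis .
    qed
    ultimately show ?thesis
      unfolding rec distrib_left up down by (simp add: E_def)
  qed
qed

section \<open>Folding the two-sided sum into ballot numbers\<close>

definition riordan_sum :: "nat \<Rightarrow> 'a::comm_ring_1 \<Rightarrow> 'a" where
  "riordan_sum n q = (\<Sum>k\<le>n. (-1) ^ k * of_int (ballot (2 * n) (n - k)) * q ^ triangle k)"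

lemma T_eq_riordan_sum:
  assumes "\<bar>q\<bar> < 1"
  shows "(1 - q) ^ n * T n q = riordan_sum n q"
  using path_weight_formula[OF assms, of "2 * n" 0 n] qpoch_nonzero[of q] assms
  by (simp add: T_eq_path_weight riordan_sum_def mult_ac)

text \<open>The indices -i and i + 1 carry the same power of q with opposite signs. Their binomials
  sit in neighbouring places of the row, up to symmetry, and combine to a ballot number.\<close>

lemma riordan_sum_eq:
  fixes q :: complex
  shows "(\<Sum>k\<in>{-int n..int n}. (-1) ^ nat \<bar>k\<bar> * q ^ nat (k * (k - 1) div 2)
        * of_nat ((2*n) choose nat (int n + k))) = riordan_sum n q"
proof -
  define f where "f k = (-1) ^ nat \<bar>k\<bar> * q ^ nat (k * (k - 1) div 2)
        * of_nat ((2*n) choose nat (int n + k))" for k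
  have tri: "nat (int k * (int k + 1) div 2) = triangle k" for k
  proof -
    have "int k * (int k + 1) div 2 = int (triangle k)"
      by (simp add: triangle_def zdiv_int distrib_left)
    then show ?thesis by simp
  qed
  have split: "{-int n..int n} = (\<lambda>i. - int i) ` {..n} \<union> (\<lambda>i. int i + 1) ` {..<n}" (is "?l = ?r")
  proof
    show "?l \<subseteq> ?r"
    proof
      fix k assume k: "k \<in> ?l"
      show "k \<in> ?r"
      proof (cases "k \<le> 0")
        case True
        then show ?thesis using k by (intro UnI1 image_eqI[of _ _ "nat (-k)"]) auto
      next
        case False
        then show ?thesis using k by (intro UnI2 image_eqI[of _ _ "nat (k - 1)"]) auto
      qed
    qed
  qed auto
  have neg: "f (- int i) = (-1) ^ i * q ^ triangle i * of_nat ((2*n) choose (n - i))" if "i \<le> n" for i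
  proof -
    have "- int i * (- int i - 1) = int i * (int i + 1)" by (simp add: algebra_simps)
    moreover have "nat (int n + - int i) = n - i" by simp
    ultimately show ?thesis unfolding f_def using tri[of i] by simp
  qed
  have pos: "f (int i + 1) = - ((-1) ^ i * q ^ triangle i * of_nat ((2*n) choose (n - i - 1)))" if "i < n" for i
  proof -
    have 1: "(int i + 1) * (int i + 1 - 1) = int i * (int i + 1)" by (simp add: algebra_simps)
    have 2: "nat \<bar>int i + 1\<bar> = Suc i" by simp
    have "nat (int n + (int i + 1)) = n + i + 1" by simp
    then have "(2*n) choose nat (int n + (int i + 1)) = (2*n) choose (n - i - 1)"
      using that by (subst binomial_symmetric) (auto intro: arg_cong2)
    then show ?thesis unfolding f_def 1 2 using tri[of i] by simp
  qed
  have "sum f {-int n..int n} = (\<Sum>i\<le>n. f (- int i)) + (\<Sum>i<n. f (int i + 1))"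
    unfolding split
    by (subst sum.union_disjoint) (auto simp: sum.reindex inj_on_def)
  also have "(\<Sum>i\<le>n. f (- int i)) = (\<Sum>i\<le>n. (-1) ^ i * q ^ triangle i * of_nat ((2*n) choose (n - i)))"
    by (intro sum.cong) (simp_all add: neg)
  \<comment> \<open>The index \<open>i = n\<close> has no partner; the 0 filled in here agrees with
    the case \<open>m = 0\<close> of \<open>ballot\<close>.\<close>
  also have "(\<Sum>i<n. f (int i + 1)) =
      (\<Sum>i\<le>n. if i < n then - ((-1) ^ i * q ^ triangle i * of_nat ((2*n) choose (n - i - 1))) else 0)"
    by (simp add: lessThan_Suc_atMost[symmetric] pos)
  finally show ?thesis
    unfolding f_def[symmetric] riordan_sum_def sum.distrib[symmetric]
    by (auto intro!: sum.cong simp: ballot_def algebra_simps)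
qed

lemma TR_eq: "TR n q = riordan_sum n q / (1 - q) ^ n"
  unfolding TR_def riordan_sum_eq by simp

lemma of_real_riordan_sum: "of_real (riordan_sum n q) = riordan_sum n (of_real q)"
  by (simp add: riordan_sum_def)

lemma TR_of_real:
  assumes "-1 < x" "x < 1"
  shows "TR n (of_real x) = of_real (T n x)"
proof -
  have "\<bar>x\<bar> < 1" using assms by auto
  from T_eq_riordan_sum[OF this, of n] have "T n x = riordan_sum n x / (1 - x) ^ n"
    using assms by (simp add: field_simps)
  then show ?thesis by (simp add: TR_eq of_real_riordan_sum)
qed

section \<open>Zeros and polar derivatives\<close>

text \<open>The closed form of the ballot numbers, cleared of denominators. Both the recurrence in
  \<open>n\<close> and the ratios in \<open>k\<close> are read off from it.\<close>

lemma ballot_fact: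
  assumes "k \<le> n"
  shows "fact (n - k) * fact (n + k + 1) * (of_int (ballot (2 * n) (n - k)) :: real) =
    (2 * real k + 1) * fact (2 * n)"
proof (cases "k = n")
  case True
  have "2 * n = n + n" by simp
  then show ?thesis using True by (simp only:) (simp add: algebra_simps)
next
  case False
  define m where "m = n - k - 1"
  have n: "n = k + m + 1" using assms False by (simp add: m_def)
  have 1: "fact (Suc m) * fact (2 * k + m + 1) * real ((2 * n) choose Suc m) = fact (2 * n)"
  proof -
    have "2 * n - Suc m = 2 * k + m + 1" "Suc m \<le> 2 * n" using n by auto
    then show ?thesis
      using binomial_fact[of "Suc m" "2 * n", where 'a = real] by (simp del: fact_Suc)
  qed
  have 2: "fact m * fact (2 * k + m + 2) * real ((2 * n) choose m) = fact (2 * n)"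
  proof -
    have "2 * n - m = 2 * k + m + 2" "m \<le> 2 * n" using n by auto
    then show ?thesis
      using binomial_fact[of m "2 * n", where 'a = real] by (simp del: fact_Suc)
  qed
  have "fact (Suc m) * fact (2 * k + m + 2) * (real ((2 * n) choose Suc m) - real ((2 * n) choose m)) =
      (2 * k + m + 2) * (fact (Suc m) * fact (2 * k + m + 1) * real ((2 * n) choose Suc m)) -
      (m + 1) * (fact m * fact (2 * k + m + 2) * real ((2 * n) choose m))"
    by (simp add: algebra_simps)
  also have "\<dots> = (2 * real k + 1) * fact (2 * n)"
    unfolding 1 2 by (simp add: algebra_simps)
  finally have "fact (Suc m) * fact (2 * k + m + 2) * (real ((2 * n) choose Suc m) - real ((2 * n) choose m)) =
    (2 * real k + 1) * fact (2 * n)" .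
  moreover have "n - k = Suc m" "n + k + 1 = 2 * k + m + 2" using n by auto
  moreover have "ballot (2 * n) (Suc m) = int ((2 * n) choose Suc m) - int ((2 * n) choose m)"
    by (simp add: ballot_def)
  ultimately show ?thesis
    by (simp only: of_int_diff of_int_of_nat_eq)
qed

text \<open>Twice the difference of the triangular numbers is (n + 1 - k)(n + k + 2), which are
  exactly the factors that the factorials in \<open>ballot_fact\<close> gain from n to n + 1. What
  remains is independent of \<open>k\<close>, so the recurrence lifts to the generating
  polynomials.\<close>

lemma ballot_rec:
  assumes "k \<le> n"
  shows "(real (triangle (Suc n)) - real (triangle k)) * of_int (ballot (2 * Suc n) (Suc n - k)) =
    real ((n + 1) * (2 * n + 1)) * of_int (ballot (2 * n) (n - k))"
proof -
  let ?x = "of_int (ballot (2 * Suc n) (Suc n - k)) :: real" and ?y = "of_int (ballot (2 * n) (n - k)) :: real"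
  let ?c = "fact (n - k) * fact (n + k + 1) :: real"
  have tri: "2 * real (triangle j) = real j * (real j + 1)" for j
  proof -
    have "2 * triangle j = j * (j + 1)" by (simp add: triangle_def)
    then show ?thesis by (metis of_nat_1 of_nat_add of_nat_mult of_nat_numeral)
  qed
  have "2 * (real (triangle (Suc n)) - real (triangle k)) = (real (Suc n) - k) * (n + k + 2)"
    unfolding right_diff_distrib tri by (simp add: algebra_simps)
  moreover have "2 * ((real (triangle (Suc n)) - real (triangle k)) * ?x * ?c) =
      2 * (real (triangle (Suc n)) - real (triangle k)) * ?c * ?x"
    by (simp only: mult_ac)
  ultimately have "2 * ((real (triangle (Suc n)) - real (triangle k)) * ?x * ?c) =
     (real (Suc n) - k) * (n + k + 2) * ?c * ?x"
    by (simp only:)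
  also have "(real (Suc n) - k) * (n + k + 2) * ?c = fact (Suc n - k) * fact (Suc n + k + 1)"
    using assms by (simp add: Suc_diff_le of_nat_diff algebra_simps)
  also have "\<dots> * ?x = (2 * real k + 1) * fact (2 * Suc n)"
    using ballot_fact[of k "Suc n"] assms by simp
  also have "\<dots> = 2 * (n + 1) * (2 * n + 1) * ((2 * real k + 1) * fact (2 * n))"
    by (simp add: algebra_simps)
  also have "\<dots> = 2 * ((n + 1) * (2 * n + 1) * ?y * ?c)"
    unfolding ballot_fact[OF assms, symmetric] by (simp only: mult_ac)
  finally have "(real (triangle (Suc n)) - real (triangle k)) * ?x * ?c = real ((n + 1) * (2 * n + 1)) * ?y * ?c"
    by simp
  moreover have "?c \<noteq> 0" by simp
  ultimately show ?thesis by (metis mult_right_cancel)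
qed

text \<open>Laguerre's theorem on polar derivatives: each zero \<open>a\<close> contributes \<open>Re (z / (z - a)) \<le> 1/2\<close>
  as soon as \<open>\<bar>z\<bar> \<le> \<bar>a\<bar>\<close>.\<close>

lemma Re_log_derivative_le:
  fixes p :: "complex poly"
  assumes "\<And>z. norm z < r \<Longrightarrow> poly p z \<noteq> 0" "norm z < r"
  shows "Re (z * poly (pderiv p) z / poly p z) \<le> degree p / 2"
  using assms(1)
proof (induction "degree p" arbitrary: p)
  case 0
  then have "pderiv p = 0" by (simp add: pderiv_eq_0_iff)
  then show ?case by simp
next
  case (Suc d)
  then have "\<not> constant (poly p)"
    by (simp add: constant_degree)
  then obtain a where a: "poly p a = 0"
    using fundamental_theorem_of_algebra by blast
  then obtain s where s: "p = [:- a, 1:] * s"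
    by (metis dvdE poly_eq_0_iff_dvd)
  have "p \<noteq> 0" using Suc by auto
  then have deg: "degree p = Suc (degree s)"
    using s by (subst s, subst degree_mult_eq) auto
  have ra: "r \<le> norm a" using Suc.prems a by force
  have nz: "poly s w \<noteq> 0" if "norm w < r" for w
    using Suc.prems[OF that] s by auto
  have "z \<noteq> a" using ra assms(2) by auto
  have "poly (pderiv p) z = poly s z + (z - a) * poly (pderiv s) z"
    unfolding s pderiv_mult by (simp add: pderiv_pCons algebra_simps)
  moreover have "poly p z = (z - a) * poly s z"
    unfolding s by (simp add: algebra_simps)
  moreover have "z * (S + (z - a) * S') / ((z - a) * S) = z / (z - a) + z * S' / S"
    if "S \<noteq> 0" for S S'
    using that \<open>z \<noteq> a\<close> by (simp add: divide_simps distrib_left mult_ac)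
  ultimately have "z * poly (pderiv p) z / poly p z = z / (z - a) + z * poly (pderiv s) z / poly s z"
    using nz[OF assms(2)] by simp
  moreover have "Re (z / (z - a)) \<le> 1 / 2"
  proof -
    have "Re z * (Re z - Re a) + Im z * (Im z - Im a) =
       ((norm (z - a))\<^sup>2 + ((norm z)\<^sup>2 - (norm a)\<^sup>2)) / 2"
      unfolding cmod_power2 by (simp add: power2_eq_square algebra_simps)
    also have "\<dots> \<le> (norm (z - a))\<^sup>2 / 2"
      using ra assms(2) power_mono[of "norm z" "norm a" 2] by simp
    finally show ?thesis
      using \<open>z \<noteq> a\<close> by (simp add: Re_divide' divide_le_eq)
  qed
  moreover have "Re (z * poly (pderiv s) z / poly s z) \<le> degree s / 2"
    using Suc nz deg by simp
  ultimately show ?case using deg by simp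
qed

section \<open>Descent of zero-freeness from n + 1 to n\<close>

definition riordan_poly :: "nat \<Rightarrow> complex poly" where
  "riordan_poly n = (\<Sum>k\<le>n. monom ((-1) ^ k * of_int (ballot (2 * n) (n - k))) (triangle k))"

lemma poly_riordan_poly: "poly (riordan_poly n) z = riordan_sum n z"
  by (simp add: riordan_poly_def riordan_sum_def poly_sum poly_monom)

lemma triangle_mono: "k \<le> n \<Longrightarrow> triangle k \<le> triangle n"
  unfolding triangle_def by (intro div_le_mono mult_le_mono) auto

lemma degree_riordan_poly: "degree (riordan_poly n) \<le> triangle n"
  unfolding riordan_poly_def
  by (intro degree_sum_le order_trans[OF degree_monom_le]) (auto simp: triangle_mono)

text \<open>This is \<open>ballot_rec\<close> coefficient by coefficient; the term
  \<open>k = Suc n\<close> disappears because the difference of triangular numbers is 0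
  there.\<close>

lemma polar_derivative_riordan_poly:
  fixes z :: complex
  shows "of_nat (triangle (Suc n)) * riordan_sum (Suc n) z - z * poly (pderiv (riordan_poly (Suc n))) z =
     of_nat ((n + 1) * (2 * n + 1)) * riordan_sum n z"
proof -
  have "z * poly (pderiv (riordan_poly (Suc n))) z =
    (\<Sum>k\<le>Suc n. of_nat (triangle k) * ((-1) ^ k * of_int (ballot (2 * Suc n) (Suc n - k))) * z ^ triangle k)"
  proof -
    have *: "z * (of_nat j * z ^ (j - 1)) = of_nat j * z ^ j" for j
      by (cases j) auto
    then have "z * poly (pderiv (monom c j)) z = of_nat j * c * z ^ j" for c j
      using *[of j] by (simp add: pderiv_monom poly_monom mult_ac)
    then show ?thesis
      by (simp only: riordan_poly_def higher_pderiv_sum[of 1, simplified] poly_sum sum_distrib_left mult_ac)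
  qed
  then have "of_nat (triangle (Suc n)) * riordan_sum (Suc n) z - z * poly (pderiv (riordan_poly (Suc n))) z =
    (\<Sum>k\<le>Suc n. (of_nat (triangle (Suc n)) - of_nat (triangle k)) *
        ((-1) ^ k * of_int (ballot (2 * Suc n) (Suc n - k))) * z ^ triangle k)"
    unfolding riordan_sum_def sum_distrib_left
    by (simp only: sum_subtractf[symmetric] left_diff_distrib mult.assoc)
  also have "\<dots> = (\<Sum>k\<le>n. (-1) ^ k * (of_nat ((n + 1) * (2 * n + 1)) * of_int (ballot (2 * n) (n - k))) * z ^ triangle k)"
  proof -
    have "(of_nat (triangle (Suc n)) - of_nat (triangle k)) * of_int (ballot (2 * Suc n) (Suc n - k)) =
      (of_nat ((n + 1) * (2 * n + 1)) * of_int (ballot (2 * n) (n - k)) :: complex)" if "k \<le> n" for k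
      using arg_cong[OF ballot_rec[OF that], where f = "of_real :: real \<Rightarrow> complex"]
      by (simp only: of_real_mult of_real_diff of_real_of_nat_eq of_real_of_int_eq)
    then show ?thesis
      by (simp add: mult_ac del: triangle_simps)
  qed
  finally show ?thesis
    by (simp add: riordan_sum_def sum_distrib_left mult_ac)
qed

text \<open>With p = \<open>riordan_poly (Suc n)\<close> and N = \<open>triangle (Suc n)\<close>, a
  zero of \<open>riordan_sum n\<close> at z would force z p'(z) / p(z) = N, whereas the real part is
  at most N / 2.\<close>

lemma riordan_sum_nonzero_step:
  assumes "\<And>z::complex. norm z < r \<Longrightarrow> riordan_sum (Suc n) z \<noteq> 0" "norm (z::complex) < r"
  shows "riordan_sum n z \<noteq> 0"
proof
  assume "riordan_sum n z = 0"
  then have "z * poly (pderiv (riordan_poly (Suc n))) z / poly (riordan_poly (Suc n)) z = triangle (Suc n)"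
    using polar_derivative_riordan_poly[of n z] assms(1)[OF assms(2)]
    by (simp add: poly_riordan_poly field_simps del: triangle_simps)
  then have "real (triangle (Suc n)) \<le> degree (riordan_poly (Suc n)) / 2"
    using Re_log_derivative_le[of r "riordan_poly (Suc n)" z] assms
    by (simp add: poly_riordan_poly del: triangle_simps)
  also have "\<dots> \<le> triangle (Suc n) / 2"
    using degree_riordan_poly[of "Suc n"] by (simp del: triangle_simps)
  finally show False by simp
qed

lemma riordan_sum_nonzero_down:
  assumes "\<And>z::complex. norm z < r \<Longrightarrow> riordan_sum (n + d) z \<noteq> 0" "norm (z::complex) < r"
  shows "riordan_sum n z \<noteq> 0"
  using assms
proof (induction d arbitrary: z)
  case (Suc d)
  show ?case
    by (rule Suc.IH) (use Suc.prems riordan_sum_nonzero_step[of r "n + d"] in auto)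
qed simp

section \<open>Jacobi's identity for the cube of the Euler product\<close>

text \<open>The Gaussian binomial coefficient, written as a quotient so that limits can be taken
  factor by factor.\<close>

definition qbinom :: "'a::field \<Rightarrow> nat \<Rightarrow> nat \<Rightarrow> 'a" where
  "qbinom q N j = (if j \<le> N then qpoch q N / (qpoch q j * qpoch q (N - j)) else 0)"

lemma qbinom_Suc_Suc:
  fixes q :: "'a::real_normed_field"
  assumes q: "norm q < 1" and j: "j \<le> N"
  shows "qbinom q (Suc N) (Suc j) = qbinom q N (Suc j) + q ^ (N - j) * qbinom q N j"
proof (cases "j = N")
  case True
  then show ?thesis using qpoch_nonzero[OF q] by (simp add: qbinom_def del: qpoch_simps(2))
next
  case False
  then obtain d where d: "N = Suc (j + d)"
    using j by (metis le_neq_implies_less less_iff_Suc_add)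
  define a b where "a = q ^ Suc j" and "b = q ^ Suc d"
  have nz: "1 - a \<noteq> 0" "1 - b \<noteq> 0" "qpoch q j \<noteq> 0" "qpoch q d \<noteq> 0"
    using power_Suc_neq_1[OF q] qpoch_nonzero[OF q] by (auto simp: a_def b_def simp del: power_Suc)
  have ab: "q ^ Suc N = a * b" by (simp add: a_def b_def d power_add)
  have "qpoch q (Suc N) = qpoch q N * (1 - a * b)" "qpoch q (Suc j) = qpoch q j * (1 - a)"
    "qpoch q (N - j) = qpoch q d * (1 - b)" "q ^ (N - j) = b"
    using ab by (simp_all add: a_def b_def d)
  moreover have "Suc N - Suc j = N - j" "N - Suc j = d" "Suc j \<le> Suc N" "Suc j \<le> N"
    using d by auto
  \<comment> \<open>The Pascal rule comes down to 1 - ab = (1 - b) + b (1 - a).\<close>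
  moreover have "Q * (1 - a * b) / (x * (1 - a) * (y * (1 - b))) =
    Q / (x * (1 - a) * y) + b * (Q / (x * (y * (1 - b))))" if "x \<noteq> 0" "y \<noteq> 0" for Q x y
    using that nz(1,2) by (simp add: divide_simps) (simp add: algebra_simps)
  ultimately show ?thesis
    using nz(3,4) j unfolding qbinom_def by (simp only: if_True)
qed

text \<open>Here \<open>triangle (j - 1)\<close> is j (j - 1) / 2, also at j = 0 thanks to truncated
  subtraction.\<close>

lemma q_binomial_theorem:
  fixes q :: "'a::real_normed_field"
  assumes q: "norm q < 1"
  shows "(\<Prod>i<N. 1 + z * q ^ i) = (\<Sum>j\<le>N. q ^ triangle (j - 1) * qbinom q N j * z ^ j)"
proof (induction N)
  case 0
  then show ?case by (simp add: qbinom_def)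
next
  case (Suc N)
  define f where "f j = q ^ triangle (j - 1) * qbinom q N j * z ^ j" for j
  have qb0: "qbinom q M 0 = 1" for M
    using qpoch_nonzero[OF q, of M] by (simp add: qbinom_def)
  have "(\<Sum>j\<le>Suc N. q ^ triangle (j - 1) * qbinom q (Suc N) j * z ^ j) =
     1 + (\<Sum>j\<le>N. q ^ triangle j * qbinom q (Suc N) (Suc j) * z ^ Suc j)"
    by (subst sum.atMost_Suc_shift) (simp add: qb0)
  also have "(\<Sum>j\<le>N. q ^ triangle j * qbinom q (Suc N) (Suc j) * z ^ Suc j) =
     (\<Sum>j\<le>N. f (Suc j) + f j * (z * q ^ N))"
  proof (intro sum.cong refl)
    fix j assume "j \<in> {..N}"
    then have j: "j \<le> N" by simp
    then have "triangle j + (N - j) = triangle (j - 1) + N"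
      by (cases j) auto
    then have "q ^ triangle j * q ^ (N - j) = q ^ triangle (j - 1) * q ^ N"
      by (simp flip: power_add)
    then show "q ^ triangle j * qbinom q (Suc N) (Suc j) * z ^ Suc j = f (Suc j) + f j * (z * q ^ N)"
      unfolding f_def qbinom_Suc_Suc[OF q j] by (simp add: algebra_simps)
  qed
  also have "1 + \<dots> = (f 0 + (\<Sum>j\<le>N. f (Suc j))) + (\<Sum>j\<le>N. f j) * (z * q ^ N)"
    by (simp add: sum.distrib sum_distrib_right f_def qb0)
  also have "f 0 + (\<Sum>j\<le>N. f (Suc j)) = (\<Sum>j\<le>N. f j)"
    using sum.atMost_Suc_shift[of f N] by (simp add: f_def qbinom_def)
  finally show ?case
    using Suc by (simp add: f_def algebra_simps)
qed

text \<open>Exponents for the lower half of the sum in \<open>jacobi_cube_finite\<close>;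
  \<open>triangle_add\<close> serves the upper half.\<close>

lemma triangle_diff: "triangle (d - 1) + triangle (k + d) = triangle k + (k + d) * d"
proof (induction d)
  case (Suc d)
  have "triangle d = triangle (d - 1) + d" by (cases d) auto
  then show ?case using Suc by simp
qed simp

lemma triangle_add: "triangle (m + k) + triangle m = triangle k + m * (m + 1 + k)"
  by (induction m) auto

text \<open>Each factor satisfies (1 - q^(-j)) q^j = -(1 - q^j), and the exponents 1, ..., m add up
  to \<open>triangle m\<close>.\<close>

lemma prod_inverse_qpoch:
  fixes q :: "'a::field"
  assumes "q \<noteq> 0"
  shows "(\<Prod>i<m. 1 - q ^ i / q ^ m) * q ^ triangle m = (-1) ^ m * qpoch q m"
proof -
  have "(\<Prod>i<m. 1 - q ^ i / q ^ m) = (\<Prod>i<m. 1 - 1 / q ^ Suc i)"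
  proof -
    have "(\<Prod>i<m. 1 - q ^ i / q ^ m) = (\<Prod>i<m. 1 - q ^ (m - Suc i) / q ^ m)"
      by (subst prod.nat_diff_reindex[symmetric]) simp
    also have "\<dots> = (\<Prod>i<m. 1 - 1 / q ^ Suc i)"
      using assms by (intro prod.cong) (simp_all add: power_diff)
    finally show ?thesis .
  qed
  also have "(\<Prod>i<m. 1 - 1 / q ^ Suc i) * q ^ triangle m = (-1) ^ m * qpoch q m"
  proof (induction m)
    case (Suc m)
    have "(\<Prod>i<Suc m. 1 - 1 / q ^ Suc i) * q ^ triangle (Suc m) =
       ((\<Prod>i<m. 1 - 1 / q ^ Suc i) * q ^ triangle m) * ((1 - 1 / q ^ Suc m) * q ^ Suc m)"
      by (simp add: power_add mult_ac)
    also have "(1 - 1 / q ^ Suc m) * q ^ Suc m = - (1 - q ^ Suc m)"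
      using assms by (simp add: left_diff_distrib)
    finally show ?case unfolding Suc by (simp add: algebra_simps)
  qed simp
  finally show ?thesis .
qed

text \<open>Differentiate the \<open>q\<close>-binomial theorem for \<open>\<Prod>\<^bsub>i \<le> 2m\<^esub> (1 - w q\<^bsup>i - m\<^esup>)\<close> at \<open>w = 1\<close>, where
  only the factor with \<open>i = m\<close> vanishes.\<close>

lemma jacobi_cube_finite:
  fixes q :: complex
  assumes q: "norm q < 1" "q \<noteq> 0"
  shows "(\<Sum>k\<le>m. (-1) ^ k * (2 * of_nat k + 1) * q ^ triangle k * qbinom q (2 * m + 1) (m - k)) = qpoch q m ^ 2"
proof -
  define N where "N = 2 * m + 1"
  define g where "g i w = 1 + (- w / q ^ m) * q ^ i" for i w
  define H where "H w = (\<Prod>i<m. g i w) * (\<Prod>i<m. g (Suc m + i) w)" for w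
  define c where "c j = q ^ triangle (j - 1) * qbinom q N j * (-1) ^ j / q ^ (m * j)" for j
  have sum_eq: "(\<Prod>i<N. g i w) = (\<Sum>j\<le>N. c j * w ^ j)" for w
  proof -
    have "(- w / q ^ m) ^ j = (-1) ^ j * w ^ j / q ^ (m * j)" for j
      by (metis minus_divide_left mult_minus1 power_divide power_mult power_mult_distrib)
    then show ?thesis
      unfolding g_def q_binomial_theorem[OF q(1)] c_def by (simp add: mult_ac)
  qed
  have prod_eq: "(\<Prod>i<N. g i w) = H w * (1 - w)" for w
  proof -
    have "(\<Prod>i<N. g i w) = (\<Prod>i\<in>{0..<m}. g i w) * (\<Prod>i\<in>{m..<N}. g i w)"
      unfolding lessThan_atLeast0 by (subst prod.atLeastLessThan_concat) (auto simp: N_def)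
    also have "(\<Prod>i\<in>{m..<N}. g i w) = g m w * (\<Prod>i\<in>{0 + Suc m..<m + Suc m}. g i w)"
      by (subst prod.atLeast_Suc_lessThan) (auto simp: N_def mult_2)
    also have "(\<Prod>i\<in>{0 + Suc m..<m + Suc m}. g i w) = (\<Prod>i\<in>{0..<m}. g (Suc m + i) w)"
      by (simp only: prod.shift_bounds_nat_ivl add.commute)
    also have "g m w = 1 - w"
      using q(2) by (simp add: g_def)
    finally show ?thesis
      by (simp add: H_def lessThan_atLeast0)
  qed
  have "((\<lambda>w. \<Sum>j\<le>N. c j * w ^ j) has_field_derivative (\<Sum>j\<le>N. of_nat j * c j)) (at 1)"
    by (auto intro!: derivative_eq_intros simp: mult_ac)
  \<comment> \<open>Since 1 - w vanishes at w = 1, the product rule leaves only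
    \<open>- H 1\<close>, whatever the derivative of \<open>H\<close> is.\<close>
  moreover have "((\<lambda>w. H w * (1 - w)) has_field_derivative - H 1) (at 1)"
  proof -
    have "H holomorphic_on UNIV"
      unfolding H_def g_def by (intro holomorphic_intros) (use q in auto)
    then have "H field_differentiable at 1"
      by (simp add: holomorphic_on_def)
    then obtain D where "(H has_field_derivative D) (at 1)"
      by (auto simp: field_differentiable_def)
    then show ?thesis
      by (auto intro!: derivative_eq_intros)
  qed
  ultimately have main: "(\<Sum>j\<le>N. of_nat j * c j) = - H 1"
    unfolding sum_eq[symmetric] prod_eq by (rule DERIV_unique)
  have H1: "H 1 * q ^ triangle m = (-1) ^ m * qpoch q m ^ 2"
  proof -
    have "(\<Prod>i<m. g (Suc m + i) 1) = qpoch q m"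
      using q(2) by (simp add: g_def qpoch_def power_add)
    moreover have "(\<Prod>i<m. g i 1) * q ^ triangle m = (-1) ^ m * qpoch q m"
      using prod_inverse_qpoch[OF q(2), of m] by (simp add: g_def)
    ultimately show ?thesis
      by (simp add: H_def power2_eq_square mult_ac)
  qed
  \<comment> \<open>The coefficients at m - k and m + 1 + k agree up to sign after multiplication by
    \<open>q ^ triangle m\<close>, so the weights combine to (m - k) - (m + 1 + k) = -(2k +
    1).\<close>
  have lo: "c (m - k) * q ^ triangle m = (-1) ^ m * ((-1) ^ k * q ^ triangle k * qbinom q N (m - k))"
    if "k \<le> m" for k
  proof -
    have "triangle (m - k - 1) + triangle m = triangle k + m * (m - k)"
      using triangle_diff[of "m - k" k] that by simp
    then have "q ^ triangle (m - k - 1) * q ^ triangle m = q ^ triangle k * q ^ (m * (m - k))"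
      by (simp flip: power_add)
    moreover have "(-1 :: complex) ^ (m - k) = (-1) ^ m * (-1) ^ k"
      using that by (simp add: minus_one_power_iff)
    ultimately show ?thesis
      unfolding c_def using q(2) by (simp add: field_simps)
  qed
  have hi: "c (m + 1 + k) * q ^ triangle m = - ((-1) ^ m * ((-1) ^ k * q ^ triangle k * qbinom q N (m - k)))"
    if "k \<le> m" for k
  proof -
    have "q ^ triangle (m + 1 + k - 1) * q ^ triangle m = q ^ triangle k * q ^ (m * (m + 1 + k))"
      using triangle_add[of m k] by (simp flip: power_add)
    moreover have "qbinom q N (m + 1 + k) = qbinom q N (m - k)"
      using that by (simp add: qbinom_def N_def mult_ac)
    ultimately show ?thesis
      unfolding c_def using q(2) by (simp add: field_simps power_add)
  qed
  have "(\<Sum>j\<le>N. of_nat j * c j) = (\<Sum>k\<le>m. of_nat (m - k) * c (m - k)) + (\<Sum>k\<le>m. of_nat (m + 1 + k) * c (m + 1 + k))"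
  proof -
    have "(\<Sum>j\<le>N. of_nat j * c j) = (\<Sum>j\<in>{0..<Suc m}. of_nat j * c j) +
        (\<Sum>j\<in>{0 + Suc m..<Suc m + Suc m}. of_nat j * c j)"
    proof -
      have "Suc N = Suc m + Suc m" by (simp add: N_def)
      then show ?thesis
        unfolding lessThan_Suc_atMost[symmetric] lessThan_atLeast0
        by (simp only: add_0_left sum.atLeastLessThan_concat)
    qed
    also have "(\<Sum>j\<in>{0 + Suc m..<Suc m + Suc m}. of_nat j * c j) =
        (\<Sum>k\<in>{0..<Suc m}. of_nat (m + 1 + k) * c (m + 1 + k))"
      by (simp only: sum.shift_bounds_nat_ivl add.commute Suc_eq_plus1)
    also have "(\<Sum>j\<in>{0..<Suc m}. of_nat j * c j) = (\<Sum>k\<in>{0..<Suc m}. of_nat (m - k) * c (m - k))"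
      using sum.nat_diff_reindex[of "\<lambda>j. of_nat j * c j" "Suc m"] by (simp add: lessThan_atLeast0)
    finally show ?thesis
      by (simp only: lessThan_atLeast0[symmetric] lessThan_Suc_atMost)
  qed
  then have "- (H 1 * q ^ triangle m) = (\<Sum>k\<le>m. of_nat (m - k) * (c (m - k) * q ^ triangle m)) +
      (\<Sum>k\<le>m. of_nat (m + 1 + k) * (c (m + 1 + k) * q ^ triangle m))"
    unfolding main minus_mult_left by (simp only: sum_distrib_right distrib_right mult.assoc)
  also have "\<dots> = (\<Sum>k\<le>m. - ((-1) ^ m) * ((-1) ^ k * (2 * of_nat k + 1) * q ^ triangle k * qbinom q N (m - k)))"
    unfolding sum.distrib[symmetric]
  proof (rule sum.cong[OF refl])
    fix k assume "k \<in> {..m}"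
    then have k: "k \<le> m" by simp
    show "of_nat (m - k) * (c (m - k) * q ^ triangle m) + of_nat (m + 1 + k) * (c (m + 1 + k) * q ^ triangle m) =
       - ((-1) ^ m) * ((-1) ^ k * (2 * of_nat k + 1) * q ^ triangle k * qbinom q N (m - k))"
      unfolding lo[OF k] hi[OF k] using k by (simp add: of_nat_diff algebra_simps)
  qed
  finally show ?thesis
    unfolding H1 sum_distrib_left[symmetric] N_def by simp
qed

section \<open>The infinite product and Jacobi's series\<close>

lemma qpoch_convergent:
  fixes q :: complex
  assumes q: "norm q < 1"
  obtains L where "qpoch q \<longlonglongrightarrow> L" "L \<noteq> 0"
proof -
  have "summable (\<lambda>i. norm (q ^ Suc i))"
    using q by (simp add: norm_power norm_mult summable_mult summable_geometric)
  then have "convergent_prod (\<lambda>i. 1 - q ^ Suc i)"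
    by (intro abs_convergent_prod_imp_convergent_prod summable_imp_abs_convergent_prod) (simp only: norm_minus_commute diff_add_cancel, simp)
  then have "(\<lambda>n. qpoch q (Suc n)) \<longlonglongrightarrow> (\<Prod>i. 1 - q ^ Suc i)" "(\<Prod>i. 1 - q ^ Suc i) \<noteq> 0"
    using convergent_prod_LIMSEQ[of "\<lambda>i. 1 - q ^ Suc i"] prodinf_nonzero[of "\<lambda>i. 1 - q ^ Suc i"] power_Suc_neq_1[OF q]
    unfolding qpoch_def lessThan_Suc_atMost by auto
  then show thesis
    by (intro that[OF LIMSEQ_imp_Suc])
qed

text \<open>Three termwise differentiations of the geometric series. The cubic weight is chosen to
  dominate both Jacobi's series and its derivative, whose coefficients grow like k^3.\<close>

lemma summable_cubic_geometric:
  fixes r :: real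
  assumes "0 \<le> r" "r < 1"
  shows "summable (\<lambda>n. real ((n + 1) * (n + 2) * (n + 3)) * r ^ n)"
proof -
  have 0: "summable (\<lambda>n. (1::real) * x ^ n)" if "norm x < 1" for x :: real
    using that by (simp add: summable_geometric)
  have 1: "summable (\<lambda>n. diffs (\<lambda>_. 1::real) n * x ^ n)" if "norm x < 1" for x :: real
    using termdiff_converges[OF that 0] by simp
  have 2: "summable (\<lambda>n. diffs (diffs (\<lambda>_. 1::real)) n * x ^ n)" if "norm x < 1" for x :: real
    using termdiff_converges[OF that 1] by simp
  have "summable (\<lambda>n. diffs (diffs (diffs (\<lambda>_. 1::real))) n * r ^ n)"
    using termdiff_converges[OF _ 2, of r] assms by simp
  moreover have "diffs (diffs (diffs (\<lambda>_. 1::real))) n = real ((n + 1) * (n + 2) * (n + 3))" for n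
    unfolding diffs_def of_nat_mult by (simp only: numeral_3_eq_3 numeral_2_eq_2) simp
  ultimately show ?thesis by (simp only:)
qed

lemma triangle_ge: "k \<le> triangle k"
  by (induction k) auto

lemma norm_jacobi_term_le:
  fixes q :: "'a::real_normed_field"
  assumes "norm q \<le> r" "r < 1"
  shows "norm ((-1) ^ k * (2 * of_nat k + 1) * q ^ triangle k) \<le> real ((k + 1) * (k + 2) * (k + 3)) * r ^ k"
proof -
  have "norm (2 * of_nat k + 1 :: 'a) = 2 * real k + 1"
  proof -
    have "2 * of_nat k + 1 = (of_nat (2 * k + 1) :: 'a)" by simp
    then show ?thesis by (simp only: norm_of_nat)
  qed
  moreover have "norm (q ^ triangle k) \<le> r ^ k"
  proof -
    have "norm (q ^ triangle k) \<le> r ^ triangle k"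
      using assms by (simp add: norm_power power_mono)
    also have "\<dots> \<le> r ^ k"
      using order_trans[OF norm_ge_zero assms(1)] assms(2) by (intro power_decreasing triangle_ge) auto
    finally show ?thesis .
  qed
  moreover have "2 * real k + 1 \<le> real ((k + 1) * (k + 2) * (k + 3))"
    by (simp add: algebra_simps)
  ultimately show ?thesis
    by (simp add: norm_mult norm_power mult_mono del: of_nat_mult)
qed

definition jacobi_cube :: "complex \<Rightarrow> complex" where
  "jacobi_cube q = (\<Sum>k. (-1) ^ k * (2 * of_nat k + 1) * q ^ triangle k)"

text \<open>Letting m grow in \<open>jacobi_cube_finite\<close> gives jacobi_cube q * L / L^2 = L^2,
  where L is the limit of \<open>qpoch q\<close>. Hence jacobi_cube q = L^3, and L is not 0.\<close>

lemma jacobi_cube_nonzero: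
  assumes q: "norm q < 1"
  shows "jacobi_cube q \<noteq> 0"
proof (cases "q = 0")
  \<comment> \<open>The finite identity divides by powers of \<open>q\<close>; at 0 only the term
    \<open>k = 0\<close> of the series survives.\<close>
  case True
  have "(\<Sum>k. (-1) ^ k * (2 * of_nat k + 1) * q ^ triangle k) =
      (\<Sum>k\<in>{0}. (-1) ^ k * (2 * of_nat k + 1) * q ^ triangle k)"
    using True by (intro suminf_finite) (auto simp: power_0_left triangle_def dest!: gr0_implies_Suc)
  then show ?thesis by (simp add: jacobi_cube_def)
next
  case False
  obtain L where L: "qpoch q \<longlonglongrightarrow> L" "L \<noteq> 0"
    using qpoch_convergent[OF q] .
  obtain M where M: "\<And>n. norm (qpoch q n) \<le> M"
    using convergent_imp_Bseq[OF convergentI[OF L(1)]] by (auto simp: Bseq_def)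
  have L': "(\<lambda>n. inverse (qpoch q n)) \<longlonglongrightarrow> inverse L"
    using L by (intro tendsto_inverse)
  obtain M' where M': "\<And>n. norm (inverse (qpoch q n)) \<le> M'"
    using convergent_imp_Bseq[OF convergentI[OF L']] by (auto simp: Bseq_def)
  define t where "t k = (-1) ^ k * (2 * of_nat k + 1) * q ^ triangle k" for k
  define a where "a k m = (if k \<le> m then t k * (qpoch q (2 * m + 1) * inverse (qpoch q (m - k)) *
      inverse (qpoch q (m + 1 + k))) else 0)" for k m
  have "(\<lambda>m. \<Sum>k. a k m) \<longlonglongrightarrow> (\<Sum>k. t k * (L * inverse L * inverse L))"
  proof (rule conjunct2[OF conjunct2[OF tannerys_theorem]])
    fix k
    have "(\<lambda>m. t k * (qpoch q (2 * m + 1) * inverse (qpoch q (m - k)) * inverse (qpoch q (m + 1 + k))))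
        \<longlonglongrightarrow> t k * (L * inverse L * inverse L)"
    proof (intro tendsto_intros L(2))
      show "(\<lambda>m. qpoch q (2 * m + 1)) \<longlonglongrightarrow> L"
        by (rule filterlim_compose[OF L(1)], rule filterlim_subseq) (auto simp: strict_mono_def)
      show "(\<lambda>m. qpoch q (m - k)) \<longlonglongrightarrow> L"
        by (rule filterlim_compose[OF L(1)]) (rule filterlim_minus_const_nat_at_top)
      show "(\<lambda>m. qpoch q (m + 1 + k)) \<longlonglongrightarrow> L"
        by (rule filterlim_compose[OF L(1)], rule filterlim_subseq) (auto simp: strict_mono_def)
    qed
    then show "(\<lambda>m. a k m) \<longlonglongrightarrow> t k * (L * inverse L * inverse L)"
      by (rule Lim_transform_eventually)
        (use eventually_ge_at_top[of k] in eventually_elim, simp add: a_def)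
  next
    \<comment> \<open>The majorant for Tannery's theorem: \<open>M\<close> and \<open>M'\<close>
      bound the q-binomial factor independently of k and m.\<close>
    have "norm (a k m) \<le> real ((k + 1) * (k + 2) * (k + 3)) * norm q ^ k * (M * M' * M')" for k m
    proof (cases "k \<le> m")
      case True
      have "norm (a k m) = norm (t k) * (norm (qpoch q (2 * m + 1)) * norm (inverse (qpoch q (m - k))) *
           norm (inverse (qpoch q (m + 1 + k))))"
        using True by (simp add: a_def norm_mult)
      also have "\<dots> \<le> (real ((k + 1) * (k + 2) * (k + 3)) * norm q ^ k) * (M * M' * M')"
        unfolding t_def using q order_trans[OF norm_ge_zero M] order_trans[OF norm_ge_zero M']
        by (intro mult_mono norm_jacobi_term_le M M' mult_nonneg_nonneg) auto
      finally show ?thesis .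
    next
      case False
      then show ?thesis
        using order_trans[OF norm_ge_zero M] order_trans[OF norm_ge_zero M'] by (simp add: a_def)
    qed
    then show "\<forall>\<^sub>F (k, m) in at_top \<times>\<^sub>F sequentially.
        norm (a k m) \<le> real ((k + 1) * (k + 2) * (k + 3)) * norm q ^ k * (M * M' * M')"
      by (intro always_eventually) auto
    show "summable (\<lambda>k. real ((k + 1) * (k + 2) * (k + 3)) * norm q ^ k * (M * M' * M'))"
      using q by (intro summable_mult2 summable_cubic_geometric) auto
  qed simp
  moreover have "(\<Sum>k. a k m) = qpoch q m ^ 2" for m
  proof -
    have "(\<Sum>k. a k m) = (\<Sum>k\<le>m. a k m)"
      by (rule suminf_finite) (auto simp: a_def)
    also have "\<dots> = (\<Sum>k\<le>m. t k * qbinom q (2 * m + 1) (m - k))"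
    proof (rule sum.cong[OF refl])
      fix k assume "k \<in> {..m}"
      then have "k \<le> m" "2 * m + 1 - (m - k) = m + 1 + k" by auto
      then show "a k m = t k * qbinom q (2 * m + 1) (m - k)"
        unfolding a_def qbinom_def by (simp add: divide_inverse del: qpoch_simps)
    qed
    finally show ?thesis
      using jacobi_cube_finite[OF q False, of m] by (simp add: t_def)
  qed
  moreover have "(\<lambda>m. qpoch q m ^ 2) \<longlonglongrightarrow> L ^ 2"
    by (intro tendsto_intros L)
  ultimately have "(\<Sum>k. t k * (L * inverse L * inverse L)) = L ^ 2"
    by (simp only:) (rule LIMSEQ_unique)
  moreover have "summable t"
    unfolding t_def
    by (rule summable_comparison_test'[OF summable_cubic_geometric[of "norm q"]])
      (use q norm_jacobi_term_le[of q "norm q"] in auto)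
  ultimately have "jacobi_cube q * (L * inverse L * inverse L) = L ^ 2"
    unfolding jacobi_cube_def t_def[symmetric] by (simp only: suminf_mult2)
  then show ?thesis using L(2) by auto
qed

section \<open>Convergence\<close>

text \<open>The ballot number at n - k divided by \<open>catalan n * (2 * k + 1)\<close>. The factor
  i = n makes it vanish for k > n, so the finite sums extend to series.\<close>

definition ballot_ratio :: "nat \<Rightarrow> nat \<Rightarrow> real" where
  "ballot_ratio n k = (\<Prod>i<k. (real n - real i) / (real n + 2 + real i))"

lemma ballot_ratio_bounds: "0 \<le> ballot_ratio n k" "ballot_ratio n k \<le> 1"
proof -
  have "0 \<le> ballot_ratio n k \<and> ballot_ratio n k \<le> 1"
  proof (cases "k \<le> n")
    case True
    then show ?thesis
      unfolding ballot_ratio_def by (auto intro!: prod_nonneg prod_le_1)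
  next
    case False
    then have "ballot_ratio n k = 0"
      unfolding ballot_ratio_def by (intro prod_zero) (auto intro: bexI[of _ n])
    then show ?thesis by simp
  qed
  then show "0 \<le> ballot_ratio n k" "ballot_ratio n k \<le> 1" by auto
qed

lemma ballot_ratio_tendsto: "(\<lambda>n. ballot_ratio n k) \<longlonglongrightarrow> 1"
proof -
  have "(\<lambda>n. \<Prod>i<k. (real n - real i) / (real n + 2 + real i)) \<longlonglongrightarrow> (\<Prod>i<k. 1)"
    by (intro tendsto_prod) real_asymp
  then show ?thesis by (simp add: ballot_ratio_def)
qed

definition catalan :: "nat \<Rightarrow> real" where
  "catalan n = of_int (ballot (2 * n) n)"

lemma catalan_eq: "catalan n = real ((2 * n) choose n) / (n + 1)"
proof -
  have "fact n * fact (n + 1) * catalan n = (fact (2 * n) :: real)"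
    using ballot_fact[of 0 n] by (simp add: catalan_def)
  moreover have "real ((2 * n) choose n) = fact (2 * n) / (fact n * fact n)"
    using binomial_fact[of n "2 * n", where 'a = real] by simp
  then have "fact n * fact n * real ((2 * n) choose n) = fact (2 * n)"
    by simp
  ultimately have "(fact n * fact n) * ((real n + 1) * catalan n) = (fact n * fact n) * real ((2 * n) choose n)"
    by (simp add: algebra_simps)
  then have "(real n + 1) * catalan n = real ((2 * n) choose n)"
    by (subst (asm) mult_cancel_left) simp
  then show ?thesis
    by (simp add: field_simps)
qed

lemma catalan_pos: "catalan n > 0"
  unfolding catalan_eq by (simp add: zero_less_binomial)

lemma ballot_eq_catalan:
  "k \<le> n \<Longrightarrow> of_int (ballot (2 * n) (n - k)) = catalan n * (2 * real k + 1) * ballot_ratio n k"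
proof (induction k)
  case 0
  then show ?case by (simp add: catalan_def ballot_ratio_def)
next
  case (Suc k)
  define d where "d = n - Suc k"
  have d: "n = Suc k + d" using Suc.prems by (simp add: d_def)
  \<comment> \<open>\<open>f\<close> and \<open>g\<close> are the factorials common to the closed
    forms for k and k + 1; they cancel.\<close>
  define f g :: real where "f = fact d" and "g = fact (n + k + 1)"
  define a b :: real where "a = of_int (ballot (2 * n) (n - k))" and "b = of_int (ballot (2 * n) (n - Suc k))"
  have "fact (n - k) = (real n - k) * f" "fact (n + Suc k + 1) = (real n + k + 2) * g"
    by (simp_all add: f_def g_def d algebra_simps)
  then have 1: "(real n - k) * f * g * a = (2 * real k + 1) * fact (2 * n)"
    and 2: "f * ((real n + k + 2) * g) * b = (2 * real (Suc k) + 1) * fact (2 * n)"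
    using ballot_fact[of k n] ballot_fact[of "Suc k" n] Suc.prems
    by (simp_all only: a_def b_def f_def[symmetric] g_def[symmetric] d_def[symmetric])
  have "(f * g) * ((2 * real k + 1) * (real n + k + 2) * b) = (f * g) * ((2 * real (Suc k) + 1) * (real n - k) * a)"
    using arg_cong[OF 1, of "\<lambda>x. (2 * real (Suc k) + 1) * x"] arg_cong[OF 2, of "\<lambda>x. (2 * real k + 1) * x"]
    by (simp only: mult_ac)
  moreover have "f * g \<noteq> 0" by (simp add: f_def g_def)
  ultimately have "(2 * real k + 1) * (real n + k + 2) * b = (2 * real (Suc k) + 1) * (real n - k) * a"
    using mult_left_cancel by blast
  also have "a = catalan n * (2 * real k + 1) * ballot_ratio n k"
    using Suc by (simp add: a_def)
  finally have "(2 * real k + 1) * ((real n + k + 2) * b) =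
      (2 * real k + 1) * (catalan n * (2 * real (Suc k) + 1) * ((real n - k) * ballot_ratio n k))"
    by (simp only: mult_ac)
  then have "(real n + k + 2) * b = catalan n * (2 * real (Suc k) + 1) * ((real n - k) * ballot_ratio n k)"
    by simp
  also have "(real n - k) * ballot_ratio n k = (real n + k + 2) * ballot_ratio n (Suc k)"
    by (simp add: ballot_ratio_def field_simps)
  finally have "(real n + k + 2) * b = (real n + k + 2) * (catalan n * (2 * real (Suc k) + 1) * ballot_ratio n (Suc k))"
    by (simp only: mult_ac)
  then show ?case
    unfolding b_def by (subst (asm) mult_cancel_left) auto
qed

section \<open>Normalised sums and their limit\<close>

definition riordan_normalized :: "nat \<Rightarrow> complex \<Rightarrow> complex" where
  "riordan_normalized n q =
     (\<Sum>k\<le>n. (-1) ^ k * (2 * of_nat k + 1) * q ^ triangle k * of_real (ballot_ratio n k))"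

lemma riordan_sum_eq_normalized:
  "riordan_sum n q = of_real (catalan n) * riordan_normalized n q"
proof -
  have "of_int (ballot (2 * n) (n - k)) =
      (of_real (catalan n) * (2 * of_nat k + 1) * of_real (ballot_ratio n k) :: complex)" if "k \<le> n" for k
    using arg_cong[OF ballot_eq_catalan[OF that], of complex_of_real] by simp
  then show ?thesis
    unfolding riordan_sum_def riordan_normalized_def sum_distrib_left
    by (intro sum.cong) (simp_all add: mult_ac)
qed

text \<open>The error is at most a sum of 1 - \<open>ballot_ratio n k\<close> against a summable
  majorant free of q. Tannery's theorem sends this sum to 0, and uniformity is automatic.\<close>

lemma uniform_limit_riordan_normalized:
  assumes r: "0 \<le> r" "r < 1"
  shows "uniform_limit (cball 0 r) riordan_normalized jacobi_cube sequentially"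
proof -
  define B where "B k = real ((k + 1) * (k + 2) * (k + 3)) * r ^ k" for k
  have B: "summable B" "B k \<ge> 0" for k
    using summable_cubic_geometric[OF r] r unfolding B_def by (simp_all del: of_nat_mult)
  have lim: "(\<lambda>n. \<Sum>k. (1 - ballot_ratio n k) * B k) \<longlonglongrightarrow> (\<Sum>k. (1 - 1) * B k)"
  proof (rule conjunct2[OF conjunct2[OF tannerys_theorem]])
    show "(\<lambda>n. (1 - ballot_ratio n k) * B k) \<longlonglongrightarrow> (1 - 1) * B k" for k
      by (intro tendsto_intros ballot_ratio_tendsto)
    show "\<forall>\<^sub>F (k, n) in at_top \<times>\<^sub>F sequentially. norm ((1 - ballot_ratio n k) * B k) \<le> B k"
      using ballot_ratio_bounds B(2)
      by (intro always_eventually) (auto simp: abs_mult intro!: mult_left_le_one_le)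
  qed (use B in auto)
  have "norm (riordan_normalized n q - jacobi_cube q) \<le> (\<Sum>k. (1 - ballot_ratio n k) * B k)"
    if "q \<in> cball 0 r" for n q
  proof -
    define t where "t k = (-1) ^ k * (2 * of_nat k + 1) * q ^ triangle k" for k
    have t: "norm (t k) \<le> B k" for k
      unfolding t_def B_def using norm_jacobi_term_le[of q r k] that r by simp
    have sum_t: "summable t"
      using summable_comparison_test'[OF B(1)] t by blast
    have "summable (\<lambda>k. (1 - ballot_ratio n k) * B k)"
      using ballot_ratio_bounds B
      by (intro summable_comparison_test'[OF B(1)]) (auto simp: abs_mult intro!: mult_left_le_one_le)
    moreover have le: "norm (t k * of_real (1 - ballot_ratio n k)) \<le> (1 - ballot_ratio n k) * B k" for k
    proof -
      have "norm (t k * of_real (1 - ballot_ratio n k)) = (1 - ballot_ratio n k) * norm (t k)"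
        using ballot_ratio_bounds[of n k] by (simp add: norm_mult del: of_real_diff)
      also have "\<dots> \<le> (1 - ballot_ratio n k) * B k"
        using ballot_ratio_bounds[of n k] t by (intro mult_left_mono) auto
      finally show ?thesis .
    qed
    ultimately have "norm (\<Sum>k. t k * of_real (1 - ballot_ratio n k)) \<le> (\<Sum>k. (1 - ballot_ratio n k) * B k)"
      by (rule norm_suminf_le[rotated])
    moreover have "(\<lambda>k. t k * of_real (ballot_ratio n k)) sums riordan_normalized n q"
    proof -
      have "ballot_ratio n k = 0" if "k \<notin> {..n}" for k
        unfolding ballot_ratio_def using that by (intro prod_zero) (auto intro: bexI[of _ n])
      then show ?thesis
        unfolding riordan_normalized_def t_def by (intro sums_finite) auto
    qed
    then have "(\<lambda>k. t k - t k * of_real (ballot_ratio n k)) sums (jacobi_cube q - riordan_normalized n q)"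
      unfolding jacobi_cube_def t_def[symmetric] using sum_t by (intro sums_diff summable_sums)
    then have "(\<Sum>k. t k * of_real (1 - ballot_ratio n k)) = jacobi_cube q - riordan_normalized n q"
      by (intro sums_unique[symmetric]) (simp add: algebra_simps)
    ultimately show ?thesis
      by (simp add: norm_minus_commute)
  qed
  note bound = this
  show ?thesis
  proof (rule uniform_limitI)
    fix \<epsilon> :: real assume "\<epsilon> > 0"
    then have "\<forall>\<^sub>F n in sequentially. (\<Sum>k. (1 - ballot_ratio n k) * B k) < \<epsilon>"
      using order_tendstoD(2)[OF lim] by simp
    then show "\<forall>\<^sub>F n in sequentially. \<forall>q\<in>cball 0 r. dist (riordan_normalized n q) (jacobi_cube q) < \<epsilon>"
    proof eventually_elim
      case (elim n)
      then show ?case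
        unfolding dist_norm using bound[of _ n] by (intro ballI) (rule le_less_trans)
    qed
  qed
qed

text \<open>\<open>c\<close> is half the minimum of the modulus of \<open>jacobi_cube\<close> on the
  closed disc; the other half absorbs the approximation error.\<close>

lemma riordan_normalized_lower_bound:
  assumes r: "0 \<le> r" "r < 1"
  obtains c where "c > 0" "\<forall>\<^sub>F n in sequentially. \<forall>q\<in>cball 0 r. c \<le> norm (riordan_normalized n q)"
proof -
  note lim = uniform_limit_riordan_normalized[OF r]
  have "continuous_on (cball 0 r) jacobi_cube"
    by (rule uniform_limit_theorem[OF _ lim])
      (auto simp: riordan_normalized_def intro!: always_eventually continuous_intros)
  then have "continuous_on (cball 0 r) (\<lambda>q. norm (jacobi_cube q))"
    by (intro continuous_intros)
  then obtain x where x: "x \<in> cball 0 r" "\<And>q. q \<in> cball 0 r \<Longrightarrow> norm (jacobi_cube x) \<le> norm (jacobi_cube q)"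
    using continuous_attains_inf[of "cball 0 r" "\<lambda>q. norm (jacobi_cube q)"] r by auto
  define c where "c = norm (jacobi_cube x) / 2"
  have "c > 0" using jacobi_cube_nonzero[of x] x(1) r by (simp add: c_def)
  moreover from uniform_limitD[OF lim this]
  have "\<forall>\<^sub>F n in sequentially. \<forall>q\<in>cball 0 r. c \<le> norm (riordan_normalized n q)"
  proof eventually_elim
    case (elim n)
    show ?case
    proof
      fix q :: complex assume q: "q \<in> cball 0 r"
      have "norm (jacobi_cube q) - norm (riordan_normalized n q) \<le> dist (riordan_normalized n q) (jacobi_cube q)"
        by (metis dist_norm norm_minus_commute norm_triangle_ineq2)
      also have "\<dots> < c" using elim q by blast
      finally show "c \<le> norm (riordan_normalized n q)"
        using x(2)[OF q] by (simp add: c_def)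
    qed
  qed
  ultimately show thesis using that by blast
qed

text \<open>One disc with radius r between |q| and 1 is enough: some sum of index at least n has no
  zero in it, and the descent to n keeps r.\<close>

lemma riordan_normalized_nonzero:
  assumes "norm q < 1"
  shows "riordan_normalized n q \<noteq> 0"
proof -
  obtain r where r: "norm q < r" "r < 1" using dense assms by blast
  then have r0: "0 \<le> r" using norm_ge_zero[of q] by linarith
  obtain c where c: "c > 0" "\<forall>\<^sub>F n in sequentially. \<forall>q\<in>cball 0 r. c \<le> norm (riordan_normalized n q)"
    using riordan_normalized_lower_bound[OF r0 r(2)] by blast
  obtain d where "\<forall>q\<in>cball 0 r. c \<le> norm (riordan_normalized (n + d) q)"
    using c(2) unfolding eventually_sequentially by (metis le_add2)
  then have "riordan_sum (n + d) z \<noteq> 0" if "norm z < r" for z :: complex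
  proof -
    have "c \<le> norm (riordan_normalized (n + d) z)"
      using \<open>\<forall>q\<in>cball 0 r. _\<close> that by simp
    then show ?thesis
      using c(1) catalan_pos[of "n + d"] by (auto simp: riordan_sum_eq_normalized)
  qed
  then have "riordan_sum n q \<noteq> 0"
    using riordan_sum_nonzero_down r(1) by blast
  then show ?thesis by (simp add: riordan_sum_eq_normalized)
qed

section \<open>Holomorphic logarithms\<close>

definition riordan_normalized_deriv :: "nat \<Rightarrow> complex \<Rightarrow> complex" where
  "riordan_normalized_deriv n q = (\<Sum>k\<le>n. (-1) ^ k * (2 * of_nat k + 1) *
     (of_nat (triangle k) * q ^ (triangle k - 1)) * of_real (ballot_ratio n k))"

lemma riordan_normalized_has_derivative:
  "(riordan_normalized n has_field_derivative riordan_normalized_deriv n q) (at q)"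
  unfolding riordan_normalized_def[abs_def] riordan_normalized_deriv_def
  by (rule DERIV_sum) (auto intro!: derivative_eq_intros)

lemma riordan_normalized_deriv_bound:
  assumes r: "0 \<le> r" "r < 1"
  obtains M where "\<And>n q. q \<in> cball 0 r \<Longrightarrow> norm (riordan_normalized_deriv n q) \<le> M"
proof
  define B where "B k = real ((k + 1) * (k + 2) * (k + 3)) * r ^ k" for k
  have B: "summable B" "B k \<ge> 0" for k
    using summable_cubic_geometric[OF r] r unfolding B_def by (simp_all del: of_nat_mult)
  fix n and q :: complex assume q: "q \<in> cball 0 r"
  define t where "t k = (-1) ^ k * (2 * of_nat k + 1) *
     (of_nat (triangle k) * q ^ (triangle k - 1)) * (of_real (ballot_ratio n k) :: complex)" for k
  \<comment> \<open>The index is shifted because the term k = 0 vanishes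
    (\<open>triangle 0 = 0\<close>), and from then on the exponent
    \<open>triangle (Suc k) - 1\<close> is at least k.\<close>
  have t: "norm (t (Suc k)) \<le> B k" for k
  proof -
    have "norm (2 * of_nat (Suc k) + 1 :: complex) = real (2 * k + 3)"
    proof -
      have "2 * of_nat (Suc k) + 1 = (of_nat (2 * k + 3) :: complex)" by simp
      then show ?thesis by (simp only: norm_of_nat)
    qed
    moreover have "norm (q ^ (triangle (Suc k) - 1)) \<le> r ^ k"
    proof -
      have "norm (q ^ (triangle (Suc k) - 1)) \<le> r ^ (triangle (Suc k) - 1)"
        unfolding norm_power using q by (intro power_mono) auto
      also have "\<dots> \<le> r ^ k"
        using r by (intro power_decreasing) auto
      finally show ?thesis .
    qed
    ultimately have "norm (t (Suc k)) \<le> real (2 * k + 3) * (real (triangle (Suc k)) * r ^ k) * 1"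
      unfolding t_def using ballot_ratio_bounds[of n "Suc k"] r
      by (simp only: norm_mult norm_power norm_minus_cancel norm_one power_one mult_1_left norm_of_nat norm_of_real)
        (intro mult_mono order_refl mult_nonneg_nonneg, auto)
    also have "\<dots> = real ((2 * k + 3) * triangle (Suc k)) * r ^ k"
      by (simp only: of_nat_mult mult_ac mult_1_right mult_1_left)
    also have "\<dots> \<le> B k"
    proof -
      have "2 * triangle (Suc k) = (k + 1) * (k + 2)"
        by (simp add: triangle_def)
      then have "2 * ((2 * k + 3) * triangle (Suc k)) = (2 * k + 3) * ((k + 1) * (k + 2))"
        by (metis mult.left_commute)
      also have "\<dots> \<le> 2 * ((k + 1) * (k + 2) * (k + 3))"
        by (simp add: algebra_simps)
      finally have "(2 * k + 3) * triangle (Suc k) \<le> (k + 1) * (k + 2) * (k + 3)"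
        by simp
      then show ?thesis
        unfolding B_def using r by (intro mult_right_mono) (simp_all only: of_nat_le_iff zero_le_power)
    qed
    finally show ?thesis .
  qed
  have "riordan_normalized_deriv n q = (\<Sum>k<n. t (Suc k))"
  proof -
    have "(\<Sum>k\<le>n. t k) = t 0 + (\<Sum>k<n. t (Suc k))"
      by (simp only: sum.lessThan_Suc_shift lessThan_Suc_atMost[symmetric])
    then show ?thesis by (simp add: riordan_normalized_deriv_def t_def)
  qed
  also have "norm \<dots> \<le> (\<Sum>k<n. B k)"
    by (intro sum_norm_le t)
  also have "\<dots> \<le> suminf B"
    using B by (intro sum_le_suminf) auto
  finally show "norm (riordan_normalized_deriv n q) \<le> suminf B" .
qed

text \<open>A zero-free holomorphic function on a disc has a logarithm. Subtracting its value at 0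
  fixes the branch and leaves the exponential unchanged, because the normalised sum is 1 at
  0.\<close>

lemma riordan_log_exists:
  "\<exists>L. (\<forall>z\<in>ball 0 1. exp (L z) = riordan_normalized n z \<and>
      (L has_field_derivative riordan_normalized_deriv n z / riordan_normalized n z) (at z)) \<and> L 0 = 0"
proof -
  have hol: "riordan_normalized n holomorphic_on ball 0 1"
    using riordan_normalized_has_derivative by (auto simp: holomorphic_on_open)
  obtain g where g: "g holomorphic_on ball 0 1" "\<And>z. z \<in> ball 0 1 \<Longrightarrow> riordan_normalized n z = exp (g z)"
    using contractible_imp_holomorphic_log[OF hol convex_imp_contractible[OF convex_ball]]
      riordan_normalized_nonzero by auto
  define L where "L z = g z - g 0" for z
  have R0: "riordan_normalized n 0 = 1"
  proof -
    have "(\<Sum>k\<le>n. (-1) ^ k * (2 * of_nat k + 1) * 0 ^ triangle k * of_real (ballot_ratio n k)) =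
       (\<Sum>k\<in>{0}. (-1) ^ k * (2 * of_nat k + 1) * 0 ^ triangle k * complex_of_real (ballot_ratio n k))"
      by (intro sum.mono_neutral_right) (auto simp: power_0_left dest!: gr0_implies_Suc)
    then show ?thesis by (simp add: riordan_normalized_def ballot_ratio_def)
  qed
  have exp_L: "exp (L z) = riordan_normalized n z" if "z \<in> ball 0 1" for z
    using g(2)[OF that] g(2)[of 0] R0 by (simp add: L_def exp_diff)
  have "(L has_field_derivative riordan_normalized_deriv n z / riordan_normalized n z) (at z)"
    if z: "z \<in> ball 0 1" for z
  proof -
    have "L holomorphic_on ball 0 1"
      unfolding L_def[abs_def] by (intro holomorphic_intros g)
    then obtain D where D: "(L has_field_derivative D) (at z)"
      using z by (meson field_differentiable_def holomorphic_on_imp_differentiable_at open_ball)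
    have "((\<lambda>z. exp (L z)) has_field_derivative exp (L z) * D) (at z)"
      by (auto intro!: derivative_eq_intros D)
    then have "(riordan_normalized n has_field_derivative exp (L z) * D) (at z)"
      by (rule has_field_derivative_transform_within_open[OF _ open_ball z]) (simp add: exp_L)
    then have "exp (L z) * D = riordan_normalized_deriv n z"
      using riordan_normalized_has_derivative DERIV_unique by blast
    then have "D = riordan_normalized_deriv n z / riordan_normalized n z"
      using exp_L[OF z] by (metis exp_not_eq_zero nonzero_mult_div_cancel_left)
    then show ?thesis using D by simp
  qed
  then show ?thesis
    using exp_L by (intro exI[of _ L]) (simp add: L_def)
qed

definition riordan_log :: "nat \<Rightarrow> complex \<Rightarrow> complex" where
  "riordan_log n = (SOME L. (\<forall>z\<in>ball 0 1. exp (L z) = riordan_normalized n z \<and>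
      (L has_field_derivative riordan_normalized_deriv n z / riordan_normalized n z) (at z)) \<and> L 0 = 0)"

lemma riordan_log:
  shows "norm z < 1 \<Longrightarrow> exp (riordan_log n z) = riordan_normalized n z"
    and "norm z < 1 \<Longrightarrow> (riordan_log n has_field_derivative
           riordan_normalized_deriv n z / riordan_normalized n z) (at z)"
    and "riordan_log n 0 = 0"
  using someI_ex[OF riordan_log_exists[of n]] unfolding riordan_log_def[symmetric] by auto

text \<open>The logarithmic derivative is at most \<open>M / c\<close> for all large n, and the
  logarithm vanishes at 0, so the mean value estimate on a convex set applies.\<close>

lemma riordan_log_bound:
  assumes r: "0 \<le> r" "r < 1"
  obtains M where "\<forall>\<^sub>F n in sequentially. \<forall>q\<in>cball 0 r. norm (riordan_log n q) \<le> M"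
proof -
  obtain c where c: "c > 0" "\<forall>\<^sub>F n in sequentially. \<forall>q\<in>cball 0 r. c \<le> norm (riordan_normalized n q)"
    using riordan_normalized_lower_bound[OF r] .
  obtain M where M: "\<And>n q. q \<in> cball 0 r \<Longrightarrow> norm (riordan_normalized_deriv n q) \<le> M"
    using riordan_normalized_deriv_bound[OF r] by blast
  have "M \<ge> 0" using M[of 0 0] r order_trans[OF norm_ge_zero] by fastforce
  have "\<forall>\<^sub>F n in sequentially. \<forall>q\<in>cball 0 r. norm (riordan_log n q) \<le> M / c * 1"
    using c(2)
  proof eventually_elim
    case (elim n)
    show ?case
    proof
      fix q :: complex assume q: "q \<in> cball 0 r"
      have "norm (riordan_log n q - riordan_log n 0) \<le> M / c * norm (q - 0)"
      proof (rule field_differentiable_bound[OF convex_cball])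
        fix z :: complex assume z: "z \<in> cball 0 r"
        then show "(riordan_log n has_field_derivative riordan_normalized_deriv n z / riordan_normalized n z)
            (at z within cball 0 r)"
          using riordan_log(2)[of z n] r by (auto intro: has_field_derivative_at_within)
        show "norm (riordan_normalized_deriv n z / riordan_normalized n z) \<le> M / c"
          unfolding norm_divide using M[OF z] elim z c(1) \<open>M \<ge> 0\<close> by (intro frac_le) auto
      qed (use q r in auto)
      also have "\<dots> \<le> M / c * 1"
        using q r \<open>M \<ge> 0\<close> c(1) by (intro mult_left_mono) auto
      finally show "norm (riordan_log n q) \<le> M / c * 1"
        by (simp add: riordan_log(3))
    qed
  qed
  then show thesis using that by blast
qed

text \<open>The derivative is real on the real axis because all coefficients are, and the value at 0
  is 0; hence the logarithm stays real. This is what selects the positive root there.\<close>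

lemma Im_riordan_log_of_real:
  assumes "-1 < x" "x < 1"
  shows "Im (riordan_log n (of_real x)) = 0"
proof -
  let ?D = "\<lambda>y. riordan_normalized_deriv n (of_real y) / riordan_normalized n (of_real y)"
  have "?D y \<in> \<real>" for y :: real
    unfolding riordan_normalized_deriv_def riordan_normalized_def
    by (intro Reals_divide sum_in_Reals Reals_mult Reals_power Reals_add) auto
  then have Im0: "Im (?D y) = 0" for y :: real
    using complex_is_Real_iff by blast
  have "\<exists>c. \<forall>y\<in>{-1<..<1}. Im (riordan_log n (of_real y)) = c"
  proof (rule has_field_derivative_zero_constant)
    fix y :: real assume "y \<in> {-1<..<1}"
    then have "norm (complex_of_real y) < 1" by (simp add: abs_less_iff)
    from has_field_derivative_Im[OF has_vector_derivative_real_field[OF riordan_log(2)[OF this, of n]]]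
    show "((\<lambda>y. Im (riordan_log n (of_real y))) has_field_derivative 0) (at y within {-1<..<1})"
      unfolding Im0 .
  qed simp
  then obtain c where c: "\<And>y. y \<in> {-1<..<1} \<Longrightarrow> Im (riordan_log n (of_real y)) = c"
    by blast
  have "c = 0" using c[of 0] by (simp add: riordan_log(3))
  then show ?thesis using c[of x] assms by simp
qed

section \<open>The 2n-th roots\<close>

lemma root_catalan_tendsto: "(\<lambda>n. root (2 * n) (catalan n)) \<longlonglongrightarrow> 2"
proof (rule tendsto_sandwich)
  have root4: "root (2 * n) (4 ^ n) = 2" if "n > 0" for n
  proof -
    have "(4 :: real) ^ n = 2 ^ (2 * n)" by (simp add: power_mult)
    then show ?thesis using that by (simp add: real_root_power_cancel)
  qed
  \<comment> \<open>The lower bound comes from 4^n / (2n) being at most the central binomial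
    coefficient, divided by n + 1.\<close>
  show "\<forall>\<^sub>F n in sequentially. 2 / (2 * real n * (real n + 1)) powr (1 / (2 * real n)) \<le> root (2 * n) (catalan n)"
    using eventually_gt_at_top[of 0]
  proof eventually_elim
    case (elim n)
    have "2 / (2 * real n * (real n + 1)) powr (1 / (2 * real n)) =
        root (2 * n) (4 ^ n / (2 * real n * (real n + 1)))"
      using elim root4[OF elim] by (simp add: root_powr_inverse[of "2 * n" "2 * real n * (real n + 1)"] real_root_divide)
    also have "\<dots> \<le> root (2 * n) (catalan n)"
    proof (rule real_root_le_mono)
      show "4 ^ n / (2 * real n * (real n + 1)) \<le> catalan n"
        using divide_right_mono[OF central_binomial_lower_bound[OF elim], of "real n + 1"]
        by (simp add: catalan_eq add.commute)
    qed (use elim in simp)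
    finally show ?case .
  qed
  show "\<forall>\<^sub>F n in sequentially. root (2 * n) (catalan n) \<le> 2"
    using eventually_gt_at_top[of 0]
  proof eventually_elim
    case (elim n)
    have "catalan n \<le> real ((2 * n) choose n)"
      unfolding catalan_eq by (simp add: divide_le_eq_1 field_simps)
    also have "\<dots> \<le> 2 ^ (2 * n)"
      using binomial_le_pow2[of "2 * n" n] by (metis of_nat_le_iff of_nat_numeral of_nat_power)
    finally have "root (2 * n) (catalan n) \<le> root (2 * n) (4 ^ n)"
      using elim by (intro real_root_le_mono) (simp_all add: power_mult)
    then show ?case using root4[OF elim] by simp
  qed
  show "(\<lambda>n. 2 / (2 * real n * (real n + 1)) powr (1 / (2 * real n))) \<longlonglongrightarrow> 2"
    by real_asymp
qed simp

text \<open>Each factor is a 2n-th root of a factor of \<open>TR\<close>, with its branch fixed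
  separately: the positive real root, the logarithm vanishing at 0, and the principal square
  root.\<close>

definition riordan_root :: "nat \<Rightarrow> complex \<Rightarrow> complex" where
  "riordan_root n z = of_real (root (2 * n) (catalan n)) * exp (riordan_log n z / of_nat (2 * n)) / csqrt (1 - z)"

lemma one_minus_notin_nonpos_Reals: "norm (z :: complex) < 1 \<Longrightarrow> 1 - z \<notin> \<real>\<^sub>\<le>\<^sub>0"
  using complex_Re_le_cmod[of z] by (auto simp: complex_nonpos_Reals_iff)

lemma riordan_root_analytic: "riordan_root n analytic_on ball 0 1"
proof -
  have "riordan_log n holomorphic_on ball 0 1"
  proof (unfold holomorphic_on_open[OF open_ball], intro ballI)
    fix z :: complex assume "z \<in> ball 0 1"
    then have "norm z < 1" by simp
    then show "\<exists>f'. (riordan_log n has_field_derivative f') (at z)"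
      using riordan_log(2) by blast
  qed
  moreover have "csqrt (1 - z) \<noteq> 0" if "norm z < 1" for z
    using that by auto
  ultimately have "riordan_root n holomorphic_on ball 0 1"
    unfolding riordan_root_def[abs_def]
    by (cases "n = 0") (auto intro!: holomorphic_intros simp: one_minus_notin_nonpos_Reals)
  then show ?thesis by (simp add: analytic_on_open)
qed

lemma riordan_root_power:
  assumes "n \<ge> 1" "norm z < 1"
  shows "riordan_root n z ^ (2 * n) = TR n z"
proof -
  have "complex_of_real (root (2 * n) (catalan n)) ^ (2 * n) = of_real (catalan n)"
    using assms(1) catalan_pos[of n] by (simp flip: of_real_power)
  moreover have "exp (riordan_log n z / of_nat (2 * n)) ^ (2 * n) = riordan_normalized n z"
    using assms riordan_log(1)[of z n] by (simp flip: exp_of_nat_mult)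
  moreover have "csqrt (1 - z) ^ (2 * n) = (1 - z) ^ n"
    by (simp add: power_mult)
  ultimately show ?thesis
    unfolding riordan_root_def TR_eq riordan_sum_eq_normalized by (simp only: power_mult_distrib power_divide)
qed

lemma riordan_root_of_real:
  assumes n: "n \<ge> 1" and x: "-1 < x" "x < 1"
  shows "riordan_root n (of_real x) = of_real (gamma n x)"
proof -
  define l where "l = Re (riordan_log n (of_real x))"
  define y where "y = root (2 * n) (catalan n) * exp (l / (2 * n)) / sqrt (1 - x)"
  have "riordan_log n (of_real x) = of_real l"
    using Im_riordan_log_of_real[OF x] by (simp add: l_def complex_eq_iff)
  moreover have "csqrt (1 - of_real x) = of_real (sqrt (1 - x))"
    using csqrt_of_real_nonneg[of "1 - x"] x by simp
  ultimately have y: "riordan_root n (of_real x) = of_real y"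
    unfolding riordan_root_def y_def by (simp flip: exp_of_real)
  \<comment> \<open>Positivity singles out \<open>y\<close> among the real 2n-th roots of
    \<open>T n x\<close>; that \<open>T n x\<close> is itself positive follows from the equation
    below.\<close>
  have "y > 0"
    unfolding y_def using n x catalan_pos[of n] by (intro divide_pos_pos mult_pos_pos) auto
  have "of_real (y ^ (2 * n)) = complex_of_real (T n x)"
    using riordan_root_power[OF n, of "of_real x"] x y TR_of_real[OF x, of n]
    by (simp add: abs_less_iff)
  then have "T n x = y ^ (2 * n)" by (simp only: of_real_eq_iff)
  then have "gamma n x = y"
    unfolding gamma_def using n \<open>y > 0\<close> by (simp add: real_root_power_cancel)
  then show ?thesis using y by simp
qed

lemma riordan_root_uniform_limit:
  assumes r: "0 \<le> r" "r < 1"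
  shows "uniform_limit (cball 0 r) riordan_root (\<lambda>z. 2 / csqrt (1 - z)) sequentially"
proof -
  obtain M where M: "\<forall>\<^sub>F n in sequentially. \<forall>q\<in>cball 0 r. norm (riordan_log n q) \<le> M"
    using riordan_log_bound[OF r] .
  define C where "C = \<bar>M\<bar>"
  \<comment> \<open>The constant 3/2 comes from |exp w - 1| being at most |w| + |w| / 2 when |w| is
    at most 1/2; the denominator is the smallest possible modulus of \<open>csqrt (1 - z)\<close> on
    the disc.\<close>
  define e where "e n = (\<bar>root (2 * n) (catalan n)\<bar> * (3 / 2 * (C / (2 * real n))) +
     \<bar>root (2 * n) (catalan n) - 2\<bar>) / sqrt (1 - r)" for n
  have "(\<lambda>n. C / (2 * real n)) \<longlonglongrightarrow> 0" by real_asymp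
  then have "e \<longlonglongrightarrow> (\<bar>2\<bar> * (3 / 2 * 0) + \<bar>2 - 2\<bar>) / sqrt (1 - r)"
    unfolding e_def using r by (intro tendsto_intros root_catalan_tendsto) auto
  then have e: "e \<longlonglongrightarrow> 0" by simp
  have small: "\<forall>\<^sub>F n in sequentially. C / (2 * real n) \<le> 1 / 2"
    using order_tendstoD(2)[OF \<open>(\<lambda>n. C / (2 * real n)) \<longlonglongrightarrow> 0\<close>, of "1/2"]
    by (auto elim: eventually_mono)
  have bound: "\<forall>\<^sub>F n in sequentially. \<forall>z\<in>cball 0 r. dist (riordan_root n z) (2 / csqrt (1 - z)) \<le> dist (e n) 0"
    using M small eventually_gt_at_top[of 0]
  proof eventually_elim
    case (elim n)
    show ?case
    proof
      fix z :: complex assume z: "z \<in> cball 0 r"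
      define w where "w = riordan_log n z / of_nat (2 * n)"
      define \<rho> where "\<rho> = root (2 * n) (catalan n)"
      have "norm (riordan_log n z) \<le> C"
        using elim(1) z unfolding C_def by fastforce
      then have w: "norm w \<le> C / (2 * real n)"
        using elim(3) by (simp add: w_def norm_divide norm_mult divide_right_mono)
      then have "norm w \<le> 1 / 2" using elim(2) by simp
      then have "norm (exp w - 1 - w) \<le> norm w / 2"
        by (rule norm_exp_bounds_lemma)
      then have "norm (exp w - 1) \<le> 3 / 2 * norm w"
        using norm_triangle_ineq[of "exp w - 1 - w" w] by simp
      also have "\<dots> \<le> 3 / 2 * (C / (2 * real n))" using w by simp
      finally have ew: "norm (exp w - 1) \<le> 3 / 2 * (C / (2 * real n))" .
      have "of_real \<rho> * exp w - 2 = of_real \<rho> * (exp w - 1) + of_real (\<rho> - 2)"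
        by (simp add: algebra_simps)
      then have "norm (of_real \<rho> * exp w - 2) \<le> \<bar>\<rho>\<bar> * norm (exp w - 1) + \<bar>\<rho> - 2\<bar>"
        by (metis norm_mult norm_of_real norm_triangle_ineq)
      also have "\<dots> \<le> \<bar>\<rho>\<bar> * (3 / 2 * (C / (2 * real n))) + \<bar>\<rho> - 2\<bar>"
        using ew by (intro add_right_mono mult_left_mono) auto
      finally have num: "norm (of_real \<rho> * exp w - 2) \<le> \<bar>\<rho>\<bar> * (3 / 2 * (C / (2 * real n))) + \<bar>\<rho> - 2\<bar>" .
      have "1 - r \<le> norm (1 - z)"
        using norm_triangle_ineq2[of 1 z] z by simp
      then have den: "sqrt (1 - r) \<le> norm (csqrt (1 - z))"
        by simp
      have "dist (riordan_root n z) (2 / csqrt (1 - z)) = norm (of_real \<rho> * exp w - 2) / norm (csqrt (1 - z))"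
        by (simp only: dist_norm riordan_root_def w_def \<rho>_def norm_divide flip: diff_divide_distrib)
      also have "\<dots> \<le> (\<bar>\<rho>\<bar> * (3 / 2 * (C / (2 * real n))) + \<bar>\<rho> - 2\<bar>) / sqrt (1 - r)"
        using num den r C_def by (intro frac_le) auto
      also have "\<dots> = e n" by (simp add: e_def \<rho>_def)
      also have "\<dots> \<le> dist (e n) 0" by simp
      finally show "dist (riordan_root n z) (2 / csqrt (1 - z)) \<le> dist (e n) 0" .
    qed
  qed
  show ?thesis
  proof (rule uniform_limitI)
    fix \<epsilon> :: real assume "\<epsilon> > 0"
    from tendstoD[OF e this] bound
    show "\<forall>\<^sub>F n in sequentially. \<forall>z\<in>cball 0 r. dist (riordan_root n z) (2 / csqrt (1 - z)) < \<epsilon>"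
      by eventually_elim (meson le_less_trans)
  qed
qed

text \<open>A nonempty compact set attains its largest norm, which is below 1, and so lies in a
  closed disc of that radius.\<close>

lemma riordan_root_uniform_limit_compact:
  assumes "compact K" "K \<subseteq> ball 0 1"
  shows "uniform_limit K riordan_root (\<lambda>z. 2 / csqrt (1 - z)) sequentially"
proof (cases "K = {}")
  case False
  obtain x where x: "x \<in> K" "\<And>y. y \<in> K \<Longrightarrow> norm y \<le> norm x"
    using continuous_attains_sup[OF assms(1) False, of norm] by (auto intro: continuous_intros)
  then have "K \<subseteq> cball 0 (norm x)" by auto
  moreover have "norm x < 1" using x(1) assms(2) by auto
  ultimately show ?thesis
    using uniform_limit_on_subset riordan_root_uniform_limit[of "norm x"] by fastforce
qed simp

theorem theorem1:
  "\<exists>g :: nat \<Rightarrow> complex \<Rightarrow> complex.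
     (\<forall>n\<ge>1.
        g n analytic_on ball 0 1 \<and>
        (\<forall>z\<in>ball 0 1. (g n z) ^ (2*n) = TR n z) \<and>
        (\<forall>x::real. -1 < x \<and> x < 1 \<longrightarrow> g n (complex_of_real x) = complex_of_real (gamma n x))) \<and>
     (\<forall>q\<in>ball 0 1. (\<lambda>n. g n q) \<longlonglongrightarrow> 2 / csqrt (1 - q)) \<and>
     (\<forall>K. compact K \<and> K \<subseteq> ball 0 1 \<longrightarrow>
        uniform_limit K g (\<lambda>q. 2 / csqrt (1 - q)) sequentially)"
proof (intro exI[of _ riordan_root] conjI allI impI ballI; (elim conjE)?)
  fix n :: nat assume n: "1 \<le> n"
  show "riordan_root n analytic_on ball 0 1"
    by (rule riordan_root_analytic)
  show "riordan_root n z ^ (2 * n) = TR n z" if "z \<in> ball 0 1" for z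
    using riordan_root_power[OF n] that by simp
  show "riordan_root n (complex_of_real x) = complex_of_real (gamma n x)" if "-1 < x" "x < 1" for x
    using riordan_root_of_real[OF n that] .
next
  fix q :: complex assume "q \<in> ball 0 1"
  then have "uniform_limit {q} riordan_root (\<lambda>q. 2 / csqrt (1 - q)) sequentially"
    by (intro riordan_root_uniform_limit_compact) auto
  then show "(\<lambda>n. riordan_root n q) \<longlonglongrightarrow> 2 / csqrt (1 - q)"
    by (simp add: uniform_limit_singleton)
next
  fix K :: "complex set" assume "compact K" "K \<subseteq> ball 0 1"
  then show "uniform_limit K riordan_root (\<lambda>q. 2 / csqrt (1 - q)) sequentially"
    by (rule riordan_root_uniform_limit_compact)
qed

end
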